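(* Let $\mu=\mathcal N(0,\mathcal C)$ be a centered Gaussian on $\mathbb R^{n_u}\times\mathbb R^{n_v}$ with strictly positive-definite covariance $\mathcal C=\begin{bmatrix}\mathcal C_{uu}&\mathcal C_{uv}\\ \mathcal C_{vu}&\mathcal C_{vv}\end{bmatrix}$ and marginals $\mu_u=\mathcal N(0,\mathcal C_{uu})$, $\mu_v=\mathcal N(0,\mathcal C_{vv})$. Consider the model $\nu(du,dv;A)=\frac1Z\exp(\langle u,Av\rangle)\mu_u(du)\mu_v(dv)$ with parameter $A=G^\top H\in\mathbb R^{n_u\times n_v}$, and let $\nu_{u|v}(\cdot|v;A)$, $\nu_{v|u}(\cdot|u;A)$ be its conditional distributions. If the parameter is chosen to be $A=A^\ast=\mathcal C_{uu}^{-1}\mathcal C_{uv}\mathcal C_{vv}^{-1}$, the minimizer over $\mathbb R^{n_u\times n_v}$ of the conditional loss $\mathsf L_{\mathsf{cond}}$ defined in the context, then the approximate conditional distributions are $$\nu_{u|v}(\cdot|v;A^\ast)=\mathcal N(\mathcal C_{uv}\mathcal C_{vv}^{-1}v,\ \mathcal C_{uu}),\qquad \nu_{v|u}(\cdot|u;A^\ast)=\mathcal N(\mathcal C_{vu}\mathcal C_{uu}^{-1}u,\ \mathcal C_{vv}).$$ Thus, the conditional means of $\nu$ match those of the data distribution $\mu$; however, the conditional variances of $\nu$ are strictly larger, in the cone of positive definite matrices, than those of the data distribution $\mu$, unless the data distribution is in product form with respect to $u$ and $v$, when they coincide.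
   Context: The conditionals of $\mu$ are $\mu_{u|v}(\cdot|v)=\mathcal N(\mathcal C_{uv}\mathcal C_{vv}^{-1}v,\mathcal C_{u|v})$ with $\mathcal C_{u|v}=\mathcal C_{uu}-\mathcal C_{uv}\mathcal C_{vv}^{-1}\mathcal C_{vu}$, and $\mu_{v|u}(\cdot|u)=\mathcal N(\mathcal C_{vu}\mathcal C_{uu}^{-1}u,\mathcal C_{v|u})$ with $\mathcal C_{v|u}=\mathcal C_{vv}-\mathcal C_{vu}\mathcal C_{uu}^{-1}\mathcal C_{uv}$. The model arises from linear encoders $u\mapsto Gu$, $v\mapsto Hv$ into a common latent space, through the tilting $\exp(\langle Gu,Hv\rangle)$; $Z$ is the normalizing constant. The conditional loss is $$\mathsf L_{\mathsf{cond}}(A)=-\mathbb E_{(u,v)\sim\mu}[\langle u,Av\rangle]+\tfrac12\mathbb E_{u\sim\mu_u}\log\mathbb E_{v\sim\mu_v}[e^{\langle u,Av\rangle}]+\tfrac12\mathbb E_{v\sim\mu_v}\log\mathbb E_{u\sim\mu_u}[e^{\langle u,Av\rangle}].$$ *)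

theory Defs
  imports "HOL-Probability.Probability"
begin

definition pos_def :: "real^'n^'n \<Rightarrow> bool" where
  "pos_def S \<longleftrightarrow> transpose S = S \<and> (\<forall>x. x \<noteq> 0 \<longrightarrow> 0 < x \<bullet> (S *v x))"

definition pos_semidef :: "real^'n^'n \<Rightarrow> bool" where
  "pos_semidef S \<longleftrightarrow> transpose S = S \<and> (\<forall>x. 0 \<le> x \<bullet> (S *v x))"

text \<open>Strict part of the Loewner order: the difference is a nonzero positive semidefinite
  matrix.  It need not be positive definite.\<close>

definition loewner_less :: "real^'n^'n \<Rightarrow> real^'n^'n \<Rightarrow> bool" where
  "loewner_less S T \<longleftrightarrow> pos_semidef (T - S) \<and> S \<noteq> T"

text \<open>Only meant for positive definite \<open>S\<close>.\<close>

definition gaussian :: "real^'n \<Rightarrow> real^'n^'n \<Rightarrow> (real^'n) measure" where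
  "gaussian m S = density lborel (\<lambda>x. ennreal
     (exp (- ((x - m) \<bullet> (matrix_inv S *v (x - m))) / 2) / sqrt ((2 * pi) ^ CARD('n) * det S)))"

definition mean_vec :: "(real^'n) measure \<Rightarrow> real^'n" where
  "mean_vec M = (\<integral>x. x \<partial>M)"

definition cov_mat :: "(real^'n) measure \<Rightarrow> real^'n^'n" where
  "cov_mat M = (\<chi> i j. \<integral>x. (x $ i - mean_vec M $ i) * (x $ j - mean_vec M $ j) \<partial>M)"

text \<open>A matrix indexed by the sum type \<open>'m + 'n\<close> is a two-by-two block matrix; \<open>Inl\<close> indexes
  the coordinates of \<open>u\<close> and \<open>Inr\<close> those of \<open>v\<close>.\<close>

definition block_uu :: "real^('m::finite + 'n::finite)^('m + 'n) \<Rightarrow> real^'m^'m" where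
  "block_uu C = (\<chi> i j. C $ Inl i $ Inl j)"

definition block_uv :: "real^('m::finite + 'n::finite)^('m + 'n) \<Rightarrow> real^'n^'m" where
  "block_uv C = (\<chi> i j. C $ Inl i $ Inr j)"

definition block_vu :: "real^('m::finite + 'n::finite)^('m + 'n) \<Rightarrow> real^'m^'n" where
  "block_vu C = (\<chi> i j. C $ Inr i $ Inl j)"

definition block_vv :: "real^('m::finite + 'n::finite)^('m + 'n) \<Rightarrow> real^'n^'n" where
  "block_vv C = (\<chi> i j. C $ Inr i $ Inr j)"

definition split_vec :: "real^('m::finite + 'n::finite) \<Rightarrow> (real^'m) \<times> (real^'n)" where
  "split_vec x = ((\<chi> i. x $ Inl i), (\<chi> j. x $ Inr j))"

definition joint_gaussian ::
  "real^('m::finite + 'n::finite)^('m + 'n) \<Rightarrow> ((real^'m) \<times> (real^'n)) measure" where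
  "joint_gaussian C = distr (gaussian 0 C) borel split_vec"

definition cond_loss :: "((real^'m) \<times> (real^'n)) measure \<Rightarrow> real^'n^'m \<Rightarrow> real" where
  "cond_loss \<mu> A =
     (let \<mu>u = distr \<mu> borel fst; \<mu>v = distr \<mu> borel snd in
       - (\<integral>(u, v). u \<bullet> (A *v v) \<partial>\<mu>)
       + 1/2 * (\<integral>u. ln (\<integral>v. exp (u \<bullet> (A *v v)) \<partial>\<mu>v) \<partial>\<mu>u)
       + 1/2 * (\<integral>v. ln (\<integral>u. exp (u \<bullet> (A *v v)) \<partial>\<mu>u) \<partial>\<mu>v))"

text \<open>The normalizing constant is computed in \<open>[0, \<infinity>]\<close>.  It may be infinite for
  some \<open>A\<close>, and the result is then the null measure instead of a probability measure.\<close>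

definition tilted_model ::
  "(real^'m) measure \<Rightarrow> (real^'n) measure \<Rightarrow> real^'n^'m \<Rightarrow> ((real^'m) \<times> (real^'n)) measure" where
  "tilted_model \<mu>u \<mu>v A =
     (let Z = (\<integral>\<^sup>+(u, v). ennreal (exp (u \<bullet> (A *v v))) \<partial>(\<mu>u \<Otimes>\<^sub>M \<mu>v))
      in density (\<mu>u \<Otimes>\<^sub>M \<mu>v) (\<lambda>(u, v). ennreal (exp (u \<bullet> (A *v v))) / Z))"

text \<open>\<open>K\<close> is a version of the regular conditional distribution of \<open>X\<close> given \<open>Y\<close> under \<open>M\<close>.\<close>

definition conditional_kernel ::
  "'a measure \<Rightarrow> ('a \<Rightarrow> 'b::topological_space) \<Rightarrow> ('a \<Rightarrow> 'c::topological_space)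
     \<Rightarrow> ('c \<Rightarrow> 'b measure) \<Rightarrow> bool" where
  "conditional_kernel M X Y K \<longleftrightarrow>
     K \<in> borel \<rightarrow>\<^sub>M prob_algebra borel \<and>
     (\<forall>S\<in>sets borel. \<forall>T\<in>sets borel.
        emeasure M {\<omega> \<in> space M. X \<omega> \<in> S \<and> Y \<omega> \<in> T} =
        (\<integral>\<^sup>+y\<in>T. emeasure (K y) S \<partial>(distr M borel Y)))"

text \<open>Conditional distributions are determined only up to null sets of the law of \<open>Y\<close>, so
  calling \<open>K\<close> the conditional distribution includes essential uniqueness.\<close>

definition conditional_law ::
  "'a measure \<Rightarrow> ('a \<Rightarrow> 'b::topological_space) \<Rightarrow> ('a \<Rightarrow> 'c::topological_space)
     \<Rightarrow> ('c \<Rightarrow> 'b measure) \<Rightarrow> bool" where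
  "conditional_law M X Y K \<longleftrightarrow>
     conditional_kernel M X Y K \<and>
     (\<forall>K'. conditional_kernel M X Y K' \<longrightarrow> (AE y in distr M borel Y. K' y = K y))"

end

theory Submission imports Defs begin

text \<open>The joint density of \<open>\<mu>\<close> factors as (density of \<open>v\<close>) times (Gaussian density in \<open>u\<close> with the
  Schur complement as covariance): the exponents agree by block elimination, and the normalizing
  constants agree because both sides have total mass one, so that no determinant of a block matrix
  is needed.  Completing the square in \<open>exp \<langle>u, A v\<rangle>\<close> against \<open>\<mu>\<^sub>u\<close> shifts the mean of \<open>\<mu>\<^sub>u\<close> by
  \<open>C\<^sub>u\<^sub>u A v\<close> and keeps its covariance, which gives the conditionals of \<open>\<nu>\<close>; the normalizing constant is
  finite since the remaining quadratic form in \<open>v\<close> is congruent to the Schur complement \<open>C\<^sub>v\<^sub>|\<^sub>u\<close>.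
  The loss is \<open>\<langle>A, C\<^sub>u\<^sub>u A C\<^sub>v\<^sub>v\<rangle> / 2 - \<langle>A, C\<^sub>u\<^sub>v\<rangle>\<close>, a strictly convex quadratic function of \<open>A\<close>.\<close>

section \<open>Linear change of variables\<close>

text \<open>One equation carries both halves of the statement. With \<open>a\<close>,
  \<open>b\<close>, \<open>d\<close> for the blocks \<open>uu\<close>, \<open>uv\<close>,
  \<open>vv\<close>, the matrix \<open>A\<close> solves \<open>a ** A ** d = b\<close>, which is
  stationarity of the quadratic loss. Read as \<open>a ** A = b ** matrix_inv d\<close> and
  \<open>d ** transpose A = transpose b ** matrix_inv a\<close>, it says that the two mean shifts
  caused by the tilt are the regression maps of \<mu>. For one variable fixed, the tilt is
  log-linear in the other, so it cannot touch a conditional covariance; the gap to \<mu> is the term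
  subtracted in the Schur complement, \<open>b ** matrix_inv d ** transpose b\<close> in the case of
  \<open>u\<close>. The obstacle is to have Gaussians at hand over any finite index type, sums
  included, without an order on the indices. A factorization \<open>S = Q ** transpose Q\<close>
  makes each Gaussian an affine image of a standard product measure, from which mass and moments are
  read off; this rests on the linear substitution rule for Lebesgue integrals, reduced to elementary
  matrices.\<close>

lemma borel_measurable_vec_lambda [measurable (raw)]:
  fixes f :: "'a \<Rightarrow> 'n::finite \<Rightarrow> real"
  assumes "\<And>i. (\<lambda>x. f x i) \<in> borel_measurable M"
  shows "(\<lambda>x. \<chi> i. f x i) \<in> borel_measurable M"
  by (subst borel_measurable_euclidean_space)
     (auto simp: Basis_vec_def inner_axis assms)

lemma borel_measurable_vec_nth [measurable (raw)]:
  fixes f :: "'a \<Rightarrow> real^'n"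
  assumes "f \<in> borel_measurable M"
  shows "(\<lambda>x. f x $ i) \<in> borel_measurable M"
  using borel_measurable_continuous_on[OF _ assms, of "\<lambda>x. x $ i"]
  by (simp add: continuous_on_component continuous_on_id)

lemma borel_measurable_matrix_vector_mult [measurable (raw)]:
  fixes A :: "real^'n^'m"
  assumes "f \<in> borel_measurable M"
  shows "(\<lambda>x. A *v f x) \<in> borel_measurable M"
  using borel_measurable_continuous_on[OF matrix_vector_mult_linear_continuous_on assms] .

section \<open>Lebesgue measure under elementary linear maps\<close>

lemma prod_Basis_vec:
  "(\<Prod>b\<in>(Basis :: (real^'n) set). f b) = (\<Prod>i\<in>UNIV. f (axis i 1))"
proof -
  have "(Basis :: (real^'n) set) = range (\<lambda>i. axis i 1)"
    by (auto simp: Basis_vec_def)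
  moreover have "inj (\<lambda>i::'n. axis i (1::real))"
    by (auto simp: inj_on_def axis_eq_axis)
  then have "prod f (range (\<lambda>i. axis i 1)) = (\<Prod>i\<in>UNIV. f (axis i 1))"
    by (subst prod.reindex) simp_all
  ultimately show ?thesis
    by metis
qed

text \<open>Gives access to one coordinate at a time, for shears and for integrals of products.
  Values on boxes determine Lebesgue measure, and \<open>vec_lambda\<close> pulls a box back to a
  product of intervals.\<close>

lemma lborel_vec:
  "(lborel :: (real^'n) measure) = distr (\<Pi>\<^sub>M i\<in>(UNIV::'n::finite set). lborel) borel vec_lambda"
proof (rule lborel_eqI)
  interpret product_sigma_finite "\<lambda>_::'n. lborel :: real measure" ..
  fix l u :: "real^'n"
  assume le: "\<And>b. b \<in> Basis \<Longrightarrow> l \<bullet> b \<le> u \<bullet> b"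
  have le': "l $ i \<le> u $ i" for i
    using le[of "axis i 1"] by (simp add: inner_axis axis_in_Basis_iff)
  have vimage: "vec_lambda -` box l u \<inter> space (\<Pi>\<^sub>M i\<in>(UNIV::'n set). lborel)
      = (\<Pi>\<^sub>E i\<in>(UNIV::'n set). {l $ i <..< u $ i})"
    by (auto simp: mem_box_cart space_PiM PiE_iff)
  have "emeasure (distr (\<Pi>\<^sub>M i\<in>(UNIV::'n set). lborel) borel vec_lambda) (box l u)
      = (\<Prod>i\<in>(UNIV::'n set). ennreal (u $ i - l $ i))"
    by (subst emeasure_distr, measurable) (simp add: vimage emeasure_PiM le')
  also have "\<dots> = ennreal (\<Prod>b\<in>Basis. (u - l) \<bullet> b)"
    by (simp add: prod_ennreal le' prod_Basis_vec inner_axis)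
  finally show "emeasure (distr (\<Pi>\<^sub>M i\<in>(UNIV::'n set). lborel) borel vec_lambda) (box l u)
      = ennreal (\<Prod>b\<in>Basis. (u - l) \<bullet> b)" .
qed simp

text \<open>With the other coordinates fixed, the map translates coordinate \<open>m\<close> by
  \<open>c * x n\<close>. Since \<open>m \<noteq> n\<close>, this offset does not depend on
  coordinate \<open>m\<close>, and the inner integral is translation invariant.\<close>

lemma nn_integral_lborel_shear:
  fixes g :: "real^'n \<Rightarrow> ennreal"
  assumes [measurable]: "g \<in> borel_measurable borel" and "m \<noteq> n"
  shows "(\<integral>\<^sup>+x. g (\<chi> i. if i = m then x $ m + c * x $ n else x $ i) \<partial>lborel) = (\<integral>\<^sup>+x. g x \<partial>lborel)"
proof -
  interpret product_sigma_finite "\<lambda>_::'n. lborel :: real measure" ..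
  let ?I = "UNIV - {m} :: 'n set"
  have I: "insert m ?I = UNIV" by auto
  have lb: "(\<integral>\<^sup>+x. f x \<partial>lborel)
      = (\<integral>\<^sup>+x. (\<integral>\<^sup>+y. f (vec_lambda (x(m := y))) \<partial>lborel) \<partial>(\<Pi>\<^sub>M i\<in>?I. lborel))"
    if [measurable]: "f \<in> borel_measurable borel" for f :: "real^'n \<Rightarrow> ennreal"
    using product_nn_integral_insert[of ?I m "\<lambda>x. f (vec_lambda x)"]
    by (subst lborel_vec, subst nn_integral_distr) (simp_all add: I)
  \<comment> \<open>The form \<open>c * x n + 1 * y\<close> exhibits the new coordinate as an affine
    image of \<open>y\<close> with slope one, the pattern of
    \<open>nn_integral_real_affine\<close>.\<close>
  have eq: "(\<chi> i. if i = m then vec_lambda (x(m := y)) $ m + c * vec_lambda (x(m := y)) $ n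
        else vec_lambda (x(m := y)) $ i) = vec_lambda (x(m := c * x n + 1 * y))" for x :: "'n \<Rightarrow> real" and y
    using \<open>m \<noteq> n\<close> by (auto simp: vec_eq_iff)
  have "(\<integral>\<^sup>+y. g (vec_lambda (x(m := c * x n + 1 * y))) \<partial>lborel) = (\<integral>\<^sup>+y. g (vec_lambda (x(m := y))) \<partial>lborel)"
    for x :: "'n \<Rightarrow> real"
  proof -
    have [measurable]: "(\<lambda>y. vec_lambda (x(m := y))) \<in> borel_measurable borel"
      unfolding fun_upd_def by measurable
    show ?thesis
      by (subst (2) nn_integral_real_affine[where c=1 and t="c * x n"]) simp_all
  qed
  then have "(\<integral>\<^sup>+x. (\<integral>\<^sup>+y. g (vec_lambda (x(m := c * x n + 1 * y))) \<partial>lborel) \<partial>(\<Pi>\<^sub>M i\<in>?I. lborel))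
      = (\<integral>\<^sup>+x. (\<integral>\<^sup>+y. g (vec_lambda (x(m := y))) \<partial>lborel) \<partial>(\<Pi>\<^sub>M i\<in>?I. lborel))"
    by simp
  moreover have m2: "(\<lambda>x. g (\<chi> i. if i = m then x $ m + c * x $ n else x $ i)) \<in> borel_measurable borel"
  proof -
    have "(\<lambda>x::real^'n. if i = m then x $ m + c * x $ n else x $ i) \<in> borel_measurable borel" for i
      by (cases "i = m") simp_all
    then show ?thesis by measurable
  qed
  ultimately show ?thesis
    unfolding lb[OF assms(1)] lb[OF m2] eq by blast
qed

lemma nn_integral_lborel_diagonal:
  fixes A :: "real^'n^'n" and g :: "real^'n \<Rightarrow> ennreal"
  assumes diag: "\<And>i j. i \<noteq> j \<Longrightarrow> A $ i $ j = 0" and nz: "det A \<noteq> 0"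
    and [measurable]: "g \<in> borel_measurable borel"
  shows "(\<integral>\<^sup>+x. g x \<partial>lborel) = ennreal \<bar>det A\<bar> * (\<integral>\<^sup>+x. g (A *v x) \<partial>lborel)"
proof -
  have det: "det A = (\<Prod>i\<in>UNIV. A $ i $ i)"
    by (rule det_diagonal) (use diag in auto)
  with nz have nz: "A $ i $ i \<noteq> 0" for i by simp
  have nth: "(A *v x) $ i = (A $ i $ i) * x $ i" for i x
  proof -
    have "(A *v x) $ i = (\<Sum>j\<in>UNIV. if j = i then A $ i $ i * x $ i else 0)"
      unfolding matrix_vector_mult_def vec_lambda_beta
      by (intro sum.cong refl) (use diag in auto)
    then show ?thesis by simp
  qed
  \<comment> \<open>Diagonal entries are expressed through basis vectors because
    \<open>lborel_affine_euclidean\<close> takes scaling factors indexed by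
    \<open>Basis\<close>.\<close>
  have ent: "(A *v axis i 1) \<bullet> axis i 1 = A $ i $ i" for i
    by (simp add: nth inner_axis)
  have cmp: "(A *v x) \<bullet> b = ((A *v b) \<bullet> b) * (x \<bullet> b)" if b: "b \<in> Basis" for x b :: "real^'n"
  proof -
    obtain i where "b = axis i 1"
      using b by (auto simp: Basis_vec_def)
    then show ?thesis by (simp add: inner_axis nth)
  qed
  have comp: "(\<Sum>j\<in>Basis. (((A *v j) \<bullet> j) * (x \<bullet> j)) *\<^sub>R j) = A *v x" for x
    by (subst euclidean_representation[of "A *v x", symmetric])
      (intro sum.cong refl, metis cmp)
  have "(A *v j) \<bullet> j \<noteq> 0" if "j \<in> Basis" for j
    using that nz by (auto simp: Basis_vec_def ent)
  note affine = lborel_affine_euclidean[of "\<lambda>j. (A *v j) \<bullet> j" 0, OF this]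
  have T: "(\<lambda>x. 0 + (\<Sum>j\<in>Basis. (((A *v j) \<bullet> j) * (x \<bullet> j)) *\<^sub>R j)) = (*v) A"
    by (simp only: comp add_0)
  have D: "(\<Prod>j\<in>Basis. \<bar>(A *v j) \<bullet> j\<bar>) = \<bar>det A\<bar>"
    by (simp only: prod_Basis_vec ent det abs_prod)
  have lb: "lborel = density (distr lborel borel ((*v) A)) (\<lambda>_. ennreal \<bar>det A\<bar>)"
    using affine unfolding T D .
  show ?thesis
    by (subst lb) (simp add: nn_integral_density nn_integral_distr nn_integral_cmult)
qed

text \<open>A coordinate swap sends boxes to boxes with the same side lengths up to order, and
  volumes of boxes determine the measure.\<close>

lemma nn_integral_lborel_transpose:
  fixes g :: "real^'n \<Rightarrow> ennreal"
  assumes [measurable]: "g \<in> borel_measurable borel"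
  shows "(\<integral>\<^sup>+x. g (\<chi> i. x $ Transposition.transpose m n i) \<partial>lborel) = (\<integral>\<^sup>+x. g x \<partial>lborel)"
proof -
  let ?t = "Transposition.transpose m n"
  have lb: "lborel = distr lborel borel (\<lambda>x::real^'n. \<chi> i. x $ ?t i)"
  proof (rule lborel_eqI)
    fix l u :: "real^'n"
    assume le: "\<And>b. b \<in> Basis \<Longrightarrow> l \<bullet> b \<le> u \<bullet> b"
    have le': "l $ i \<le> u $ i" for i
      using le[of "axis i 1"] by (simp add: inner_axis axis_in_Basis_iff)
    have le'': "(\<chi> i. l $ ?t i) \<bullet> b \<le> (\<chi> i. u $ ?t i) \<bullet> b" if "b \<in> Basis" for b
      using that le' by (auto simp: Basis_vec_def inner_axis)
    have "(\<lambda>x::real^'n. \<chi> i. x $ ?t i) -` box l u = box (\<chi> i. l $ ?t i) (\<chi> i. u $ ?t i)"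
      unfolding set_eq_iff vimage_def mem_box_cart mem_Collect_eq vec_lambda_beta
      by (metis transpose_involutory)
    then have "emeasure (distr lborel borel (\<lambda>x::real^'n. \<chi> i. x $ ?t i)) (box l u)
        = emeasure lborel (box (\<chi> i. l $ ?t i) (\<chi> i. u $ ?t i))"
      by (subst emeasure_distr) simp_all
    also have "\<dots> = ennreal (\<Prod>i\<in>UNIV. u $ ?t i - l $ ?t i)"
      by (simp add: emeasure_lborel_box[OF le''] prod_Basis_vec inner_axis)
    also have "(\<Prod>i\<in>UNIV. u $ ?t i - l $ ?t i) = (\<Prod>i\<in>UNIV. u $ i - l $ i)"
      by (rule prod.reindex_bij_betw[of ?t UNIV UNIV "\<lambda>i. u $ i - l $ i"]) simp
    finally show "emeasure (distr lborel borel (\<lambda>x::real^'n. \<chi> i. x $ ?t i)) (box l u)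
        = ennreal (\<Prod>b\<in>Basis. (u - l) \<bullet> b)"
      by (simp add: prod_Basis_vec inner_axis)
  qed simp
  have "(\<integral>\<^sup>+x. g (\<chi> i. x $ ?t i) \<partial>lborel) = (\<integral>\<^sup>+x. g x \<partial>distr lborel borel (\<lambda>x::real^'n. \<chi> i. x $ ?t i))"
    by (simp add: nn_integral_distr)
  then show ?thesis
    unfolding lb[symmetric] .
qed

text \<open>\<open>measure_linear_image\<close> in the library is restricted to well-ordered index types.\<close>

lemma nn_integral_lborel_linear:
  fixes A :: "real^'n^'n" and g :: "real^'n \<Rightarrow> ennreal"
  assumes "det A \<noteq> 0" and "g \<in> borel_measurable borel"
  shows "(\<integral>\<^sup>+x. g x \<partial>lborel) = ennreal \<bar>det A\<bar> * (\<integral>\<^sup>+x. g (A *v x) \<partial>lborel)"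
proof -
  \<comment> \<open>Nonsingularity sits inside the predicate because the induction also produces
    matrices with a zero row, where the claim is then vacuous; in the product case multiplicativity
    of the determinant hands the premise to both factors.\<close>
  define P where "P A \<longleftrightarrow> (det A \<noteq> 0 \<longrightarrow> (\<forall>g\<in>borel_measurable borel.
     (\<integral>\<^sup>+x. g x \<partial>lborel) = ennreal \<bar>det A\<bar> * (\<integral>\<^sup>+x. g (A *v x) \<partial>lborel)))" for A :: "real^'n^'n"
  have "P A"
  proof (rule induct_matrix_elementary[where P = P])
    fix A B :: "real^'n^'n"
    assume A: "P A" and B: "P B"
    show "P (A ** B)"
      unfolding P_def
    proof (intro impI ballI)
      fix g :: "real^'n \<Rightarrow> ennreal"
      assume d: "det (A ** B) \<noteq> 0" and [measurable]: "g \<in> borel_measurable borel"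
      have nz: "det A \<noteq> 0" "det B \<noteq> 0" using d by (auto simp: det_mul)
      have "(\<integral>\<^sup>+x. g x \<partial>lborel) = ennreal \<bar>det A\<bar> * (\<integral>\<^sup>+x. g (A *v x) \<partial>lborel)"
        by (rule A[unfolded P_def, rule_format, OF nz(1)]) simp
      also have "(\<integral>\<^sup>+x. g (A *v x) \<partial>lborel) = ennreal \<bar>det B\<bar> * (\<integral>\<^sup>+x. g (A *v (B *v x)) \<partial>lborel)"
        by (rule B[unfolded P_def, rule_format, OF nz(2)]) simp
      finally show "(\<integral>\<^sup>+x. g x \<partial>lborel)
          = ennreal \<bar>det (A ** B)\<bar> * (\<integral>\<^sup>+x. g (A ** B *v x) \<partial>lborel)"
        by (simp add: det_mul abs_mult ennreal_mult mult.assoc matrix_vector_mul_assoc)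
    qed
  next
    fix A :: "real^'n^'n" and i
    assume "row i A = 0"
    then show "P A" by (simp add: P_def det_zero_row(2))
  next
    fix A :: "real^'n^'n"
    assume "\<And>i j. i \<noteq> j \<Longrightarrow> A $ i $ j = 0"
    then show "P A"
      unfolding P_def by (blast intro: nn_integral_lborel_diagonal)
  next
    fix m n :: 'n
    assume "m \<noteq> n"
    let ?t = "Transposition.transpose m n"
    let ?A = "\<chi> i j. (mat 1 :: real^'n^'n) $ i $ ?t j"
    have "(?A *v x) $ i = x $ ?t i" for x i
    proof -
      have "(?A *v x) $ i = (\<Sum>j\<in>UNIV. if j = ?t i then x $ j else 0)"
        unfolding matrix_vector_mult_def mat_def vec_lambda_beta
        by (intro sum.cong refl) (metis mult_1 mult_zero_left transpose_involutory)
      then show ?thesis by simp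
    qed
    then have A: "?A *v x = (\<chi> i. x $ ?t i)" for x
      by (simp add: vec_eq_iff)
    have det: "\<bar>det ?A\<bar> = 1"
      by (subst det_permute_columns) (auto simp: permutes_swap_id sign_def)
    show "P ?A"
      unfolding P_def A det by (simp add: nn_integral_lborel_transpose)
  next
    fix m n :: 'n and c :: real
    assume mn: "m \<noteq> n"
    let ?A = "\<chi> i j. if i = m \<and> j = n then c else of_bool (i = j)"
    have "(?A *v x) $ i = (if i = m then x $ m + c * x $ n else x $ i)" for i and x :: "real^'n"
    proof -
      have "(?A *v x) $ i = (\<Sum>j\<in>UNIV. (if j = i then x $ j else 0)
          + (if j = n then (if i = m then c * x $ j else 0) else 0))"
        unfolding matrix_vector_mult_def vec_lambda_beta
        by (intro sum.cong refl) (use mn in auto)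
      then show ?thesis by (simp add: sum.distrib)
    qed
    then have A: "?A *v x = (\<chi> i. if i = m then x $ m + c * x $ n else x $ i)" for x
      by (simp add: vec_eq_iff)
    have "?A = (\<chi> k. if k = m then row m (mat 1) + c *s row n (mat 1) else row k (mat 1))"
      using mn by (auto simp: vec_eq_iff row_def mat_def)
    then have "det ?A = 1"
      using det_row_operation[OF mn, of "mat 1 :: real^'n^'n" c] by simp
    then show "P ?A"
      using mn by (simp add: P_def A nn_integral_lborel_shear)
  qed
  with assms show ?thesis unfolding P_def by blast
qed

section \<open>Positive definite matrices\<close>

lemma matrix_inv:
  assumes "invertible (A :: real^'n^'m)"
  shows matrix_inv_right: "A ** matrix_inv A = mat 1"
    and matrix_inv_left: "matrix_inv A ** A = mat 1"
  using someI_ex[OF assms[unfolded invertible_def]] by (auto simp: matrix_inv_def)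

lemma matrix_inv_unique:
  fixes A B :: "real^'n^'n"
  assumes "A ** B = mat 1"
  shows "matrix_inv A = B"
proof -
  have "B ** A = mat 1"
    using assms by (simp add: matrix_left_right_inverse)
  then have "invertible A" using assms by (auto simp: invertible_def)
  then have "matrix_inv A ** (A ** B) = B"
    by (simp only: matrix_mul_assoc matrix_inv_left matrix_mul_lid)
  then show ?thesis using assms by simp
qed

lemma invertible_matrix_inv:
  "invertible (A :: real^'n^'n) \<Longrightarrow> invertible (matrix_inv A)"
  using matrix_inv invertible_def by blast

lemma matrix_inv_matrix_inv:
  "invertible (A :: real^'n^'n) \<Longrightarrow> matrix_inv (matrix_inv A) = A"
  by (simp add: matrix_inv_left matrix_inv_unique)

lemma matrix_inv_vector:
  assumes "invertible (A :: real^'n^'n)"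
  shows "A *v (matrix_inv A *v x) = x" "matrix_inv A *v (A *v x) = x"
  by (simp_all add: matrix_vector_mul_assoc matrix_inv assms)

lemma inner_matrix_vector_transpose:
  fixes A :: "real^'n^'m"
  shows "x \<bullet> (A *v y) = (transpose A *v x) \<bullet> y"
  by (simp add: dot_lmul_matrix)

lemma inner_symmetric_matrix:
  fixes A :: "real^'n^'n"
  assumes "transpose A = A"
  shows "x \<bullet> (A *v y) = y \<bullet> (A *v x)"
  using inner_matrix_vector_transpose[of x A y] assms by (simp add: inner_commute)

section \<open>Inversion, congruence and factorization of positive definite matrices\<close>

lemma pos_def_invertible:
  fixes S :: "real^'n^'n"
  assumes "pos_def S"
  shows "invertible S"
proof -
  have "x = 0" if "S *v x = 0" for x
    using assms that unfolding pos_def_def by (metis inner_zero_right less_irrefl)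
  then show ?thesis
    by (simp add: invertible_left_inverse matrix_left_invertible_ker)
qed

lemma transpose_matrix_inv:
  fixes S :: "real^'n^'n"
  assumes "invertible S" "transpose S = S"
  shows "transpose (matrix_inv S) = matrix_inv S"
proof -
  have "transpose (matrix_inv S ** S) = S ** transpose (matrix_inv S)"
    by (simp add: matrix_transpose_mul assms)
  then have "S ** transpose (matrix_inv S) = mat 1"
    by (simp add: matrix_inv_left assms transpose_mat)
  then show ?thesis
    using matrix_inv_unique by metis
qed

lemma pos_def_matrix_inv:
  fixes S :: "real^'n^'n"
  assumes S: "pos_def S"
  shows "pos_def (matrix_inv S)"
  unfolding pos_def_def
proof (intro conjI allI impI)
  note inv = pos_def_invertible[OF S]
  show "transpose (matrix_inv S) = matrix_inv S"
    using S transpose_matrix_inv[OF inv] by (simp add: pos_def_def)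
  fix x :: "real^'n" assume x: "x \<noteq> 0"
  let ?y = "matrix_inv S *v x"
  have Sy: "S *v ?y = x" by (rule matrix_inv_vector[OF inv])
  then have "?y \<noteq> 0" using x by (metis matrix_vector_mult_0_right)
  then have "0 < ?y \<bullet> (S *v ?y)" using S by (simp add: pos_def_def)
  then show "0 < x \<bullet> ?y" by (simp add: Sy inner_commute)
qed

lemma pos_def_congruence:
  fixes S :: "real^'n^'n" and R :: "real^'n^'n"
  assumes S: "pos_def S" and R: "invertible R"
  shows "pos_def (transpose R ** S ** R)"
  unfolding pos_def_def
proof (intro conjI allI impI)
  show "transpose (transpose R ** S ** R) = transpose R ** S ** R"
    using S by (simp add: pos_def_def matrix_transpose_mul matrix_mul_assoc)
  fix x :: "real^'n" assume x: "x \<noteq> 0"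
  have "R *v x \<noteq> 0"
    using x matrix_inv_vector(2)[OF R, of x] by auto
  then have "0 < (R *v x) \<bullet> (S *v (R *v x))" using S by (simp add: pos_def_def)
  also have "\<dots> = x \<bullet> ((transpose R ** S ** R) *v x)"
    by (subst inner_matrix_vector_transpose[of _ "transpose R ** S ** R"])
      (metis inner_commute inner_matrix_vector_transpose matrix_vector_mul_assoc transpose_transpose
        inner_matrix_vector_transpose[of x "transpose R ** S ** R" x])
  finally show "0 < x \<bullet> ((transpose R ** S ** R) *v x)" .
qed

text \<open>Gram-Schmidt for the inner product \<open>x \<bullet> S y\<close>; the basis vectors are the rows of \<open>Q\<inverse>\<close>.\<close>

lemma pos_def_factor:
  fixes S :: "real^'n^'n"
  assumes S: "pos_def S"
  obtains Q :: "real^'n^'n" where "invertible Q" "S = Q ** transpose Q"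
proof -
  have sym: "x \<bullet> (S *v y) = y \<bullet> (S *v x)" for x y
    using S by (intro inner_symmetric_matrix) (simp add: pos_def_def)
  \<comment> \<open>Induction over finite index sets builds the orthonormal family one index at a
    time, in any order. At \<open>F = UNIV\<close> there is one vector per index, hence a square
    matrix.\<close>
  have "\<exists>b. \<forall>i\<in>F. \<forall>j\<in>F. b i \<bullet> (S *v b j) = (if i = j then 1 else 0)"
    if "finite F" for F :: "'n set"
    using that
  proof (induction F rule: finite_induct)
    case empty
    then show ?case by simp
  next
    case (insert k F)
    then obtain b where b: "b i \<bullet> (S *v b j) = (if i = j then 1 else 0)" if "i \<in> F" "j \<in> F" for i j
      by blast
    \<comment> \<open>The vectors built so far are too few to span the space, so some
      \<open>x\<close> lies outside their span and its component orthogonal to them is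
      nonzero.\<close>
    have "card F < CARD('n)"
      using insert.hyps by (metis card_insert_disjoint card_mono finite_code Suc_le_lessD subset_UNIV)
    then have "dim (b ` F) < DIM(real^'n)"
      using dim_le_card'[of "b ` F"] card_image_le[OF insert.hyps(1), of b] insert.hyps by simp
    then have "span (b ` F) \<noteq> UNIV"
      by (metis dim_UNIV dim_span less_irrefl)
    then obtain x where x: "x \<notin> span (b ` F)" by auto
    define z where "z = x - (\<Sum>i\<in>F. (b i \<bullet> (S *v x)) *\<^sub>R b i)"
    have "z \<noteq> 0"
    proof
      assume "z = 0"
      then have "x = (\<Sum>i\<in>F. (b i \<bullet> (S *v x)) *\<^sub>R b i)" by (simp add: z_def)
      moreover have "\<dots> \<in> span (b ` F)"
        by (intro span_sum span_scale span_base) auto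
      ultimately show False using x by simp
    qed
    then have pos: "0 < z \<bullet> (S *v z)" using S by (simp add: pos_def_def)
    have orth: "b j \<bullet> (S *v z) = 0" if "j \<in> F" for j
    proof -
      have "b j \<bullet> (S *v z) = b j \<bullet> (S *v x) - (\<Sum>i\<in>F. (b i \<bullet> (S *v x)) * (b j \<bullet> (S *v b i)))"
        by (simp add: z_def matrix_vector_mult_diff_distrib inner_diff_right
            linear_sum[OF matrix_vector_mul_linear] inner_sum_right matrix_vector_mult_scaleR)
      also have "(\<Sum>i\<in>F. (b i \<bullet> (S *v x)) * (b j \<bullet> (S *v b i))) = (\<Sum>i\<in>F. if i = j then b j \<bullet> (S *v x) else 0)"
        using that by (intro sum.cong) (auto simp: b)
      finally show ?thesis using that insert.hyps by simp
    qed
    define c where "c = inverse (sqrt (z \<bullet> (S *v z)))"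
    have c: "c * (c * (z \<bullet> (S *v z))) = 1"
      using pos by (simp add: c_def field_simps flip: power2_eq_square)
    show ?case
    proof (intro exI ballI)
      fix i j assume ij: "i \<in> insert k F" "j \<in> insert k F"
      have [simp]: "z \<bullet> (S *v b j) = 0" if "j \<in> F" for j
        using orth[OF that] sym by metis
      show "(b(k := c *\<^sub>R z)) i \<bullet> (S *v (b(k := c *\<^sub>R z)) j) = (if i = j then 1 else 0)"
        using ij insert.hyps(2) c
        by (auto simp: matrix_vector_mult_scaleR orth b)
    qed
  qed
  from this[of UNIV] obtain b :: "'n \<Rightarrow> real^'n" where b: "b i \<bullet> (S *v b j) = (if i = j then 1 else 0)" for i j
    by (metis UNIV_I finite)
  define R :: "real^'n^'n" where "R = (\<chi> i. b i)"
  have RSR: "R ** S ** transpose R = mat 1"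
  proof -
    have "(R ** (S ** transpose R)) $ i $ j = b i \<bullet> (S *v b j)" for i j
      by (simp add: R_def matrix_matrix_mult_def matrix_vector_mult_def transpose_def inner_vec_def)
    then show ?thesis
      by (simp add: vec_eq_iff mat_def b matrix_mul_assoc)
  qed
  have "invertible R"
    using RSR by (metis invertible_right_inverse matrix_mul_assoc)
  note inv = matrix_inv[OF this]
  let ?Q = "matrix_inv R"
  have "?Q ** transpose ?Q = ?Q ** (R ** S ** transpose R) ** transpose ?Q"
    by (simp add: RSR)
  also have "\<dots> = (?Q ** R) ** S ** transpose (?Q ** R)"
    by (simp add: matrix_transpose_mul matrix_mul_assoc)
  also have "\<dots> = S" by (simp add: inv transpose_mat)
  finally have "S = ?Q ** transpose ?Q" ..
  with that \<open>invertible R\<close> invertible_matrix_inv show thesis by blast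
qed

lemma pos_def_det_pos:
  fixes S :: "real^'n^'n"
  assumes "pos_def S"
  shows "0 < det S"
proof -
  obtain Q :: "real^'n^'n" where "invertible Q" "S = Q ** transpose Q" using assms by (rule pos_def_factor)
  then have "det S = (det Q)\<^sup>2" "det Q \<noteq> 0"
    by (simp_all add: det_mul det_transpose invertible_det_nz power2_eq_square)
  then show ?thesis by simp
qed

section \<open>Gaussian measures\<close>

lemma lborel_integral_prod_vec:
  fixes f :: "'n::finite \<Rightarrow> real \<Rightarrow> real"
  assumes "\<And>i. integrable lborel (f i)"
  shows "integrable lborel (\<lambda>x::real^'n. \<Prod>i\<in>UNIV. f i (x $ i))"
    and "(\<integral>x. (\<Prod>i\<in>UNIV. f i (x $ i)) \<partial>(lborel :: (real^'n) measure)) = (\<Prod>i\<in>UNIV. \<integral>x. f i x \<partial>lborel)"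
proof -
  interpret product_sigma_finite "\<lambda>_::'n. lborel :: real measure" ..
  have [measurable]: "f i \<in> borel_measurable borel" for i
    using borel_measurable_integrable[OF assms[of i]] by simp
  have [measurable]: "vec_lambda \<in> (\<Pi>\<^sub>M i\<in>(UNIV::'n set). lborel) \<rightarrow>\<^sub>M (borel :: (real^'n) measure)"
    by measurable
  have [measurable]: "(\<lambda>x::real^'n. \<Prod>i\<in>UNIV. f i (x $ i)) \<in> borel_measurable borel"
    by measurable
  show "integrable lborel (\<lambda>x::real^'n. \<Prod>i\<in>UNIV. f i (x $ i))"
    by (subst lborel_vec, subst integrable_distr_eq)
      (simp_all add: product_integrable_prod assms)
  show "(\<integral>x. (\<Prod>i\<in>UNIV. f i (x $ i)) \<partial>(lborel :: (real^'n) measure)) = (\<Prod>i\<in>UNIV. \<integral>x. f i x \<partial>lborel)"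
    by (subst lborel_vec, subst integral_distr)
      (simp_all add: product_integral_prod assms)
qed

text \<open>Encoded as a product density rather than as \<open>gaussian 0 (mat 1)\<close>, so that
  integrals of monomials split into one-dimensional moments.\<close>

definition std_gaussian :: "(real^'n) measure" where
  "std_gaussian = density lborel (\<lambda>x. ennreal (\<Prod>i\<in>UNIV. std_normal_density (x $ i)))"

lemma sets_std_gaussian [simp, measurable_cong]: "sets std_gaussian = sets borel"
  and space_std_gaussian [simp]: "space std_gaussian = UNIV"
  by (simp_all add: std_gaussian_def)

text \<open>Zero exponents yield the total mass, a single one the means, and two ones or a two the
  covariances.\<close>

lemma std_gaussian_moment:
  fixes e :: "'n::finite \<Rightarrow> nat"
  shows "integrable std_gaussian (\<lambda>x. \<Prod>i\<in>UNIV. x $ i ^ e i)" (is ?I)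
    and "(\<integral>x. (\<Prod>i\<in>UNIV. x $ i ^ e i) \<partial>std_gaussian)
      = (\<Prod>i\<in>UNIV. \<integral>t. std_normal_density t * t ^ e i \<partial>lborel)" (is ?E)
proof -
  have nn: "AE x::real^'n in lborel. 0 \<le> (\<Prod>i\<in>UNIV. std_normal_density (x $ i))"
    by (simp add: prod_nonneg)
  have eq: "(\<Prod>i\<in>UNIV. std_normal_density (x $ i)) *\<^sub>R (\<Prod>i\<in>UNIV. x $ i ^ e i)
      = (\<Prod>i\<in>UNIV. std_normal_density (x $ i) * x $ i ^ e i)" for x :: "real^'n"
    by (simp add: prod.distrib)
  note P = lborel_integral_prod_vec[of "\<lambda>i t. std_normal_density t * t ^ e i",
      OF integrable_std_normal_moment]
  show ?I unfolding std_gaussian_def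
    by (subst integrable_density[OF _ _ nn]) (simp_all only: eq P, measurable)
  show ?E unfolding std_gaussian_def
    by (subst integral_density[OF _ _ nn]) (simp_all only: eq P, measurable)
qed

lemma prob_space_std_gaussian: "prob_space (std_gaussian :: (real^'n) measure)"
proof
  have "integrable (std_gaussian :: (real^'n) measure) (\<lambda>x. 1 :: real)"
    using std_gaussian_moment(1)[of "\<lambda>_::'n. 0"] by simp
  moreover have "(\<integral>x. (1::real) \<partial>(std_gaussian :: (real^'n) measure)) = 1"
    using std_gaussian_moment(2)[of "\<lambda>_::'n. 0"] integral_std_normal_moment_even[of 0] by simp
  ultimately show "emeasure (std_gaussian :: (real^'n) measure) (space std_gaussian) = 1"
    by (subst emeasure_eq_ennreal_measure) (auto simp: integrable_iff_bounded)
qed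

lemma std_gaussian_first_moment:
  "integrable std_gaussian (\<lambda>x::real^'n. x $ i)" (is ?I)
  "(\<integral>x. x $ i \<partial>(std_gaussian :: (real^'n) measure)) = 0" (is ?E)
proof -
  let ?e = "\<lambda>k. if k = i then 1 else 0 :: nat"
  have eq: "(\<Prod>k\<in>UNIV. x $ k ^ ?e k) = x $ i" for x :: "real^'n"
  proof -
    have "(\<Prod>k\<in>UNIV. x $ k ^ ?e k) = (\<Prod>k\<in>UNIV. if k = i then x $ k else 1)"
      by (intro prod.cong) auto
    then show ?thesis by simp
  qed
  show ?I using std_gaussian_moment(1)[of ?e] by (simp only: eq)
  have "(\<integral>x. x $ i \<partial>std_gaussian) = (\<Prod>k\<in>UNIV. \<integral>t. std_normal_density t * t ^ ?e k \<partial>lborel)"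
    using std_gaussian_moment(2)[of ?e] by (simp only: eq)
  also have "\<dots> = 0"
    using integral_std_normal_moment_odd[of 0] by (intro prod_zero) (auto intro!: bexI[of _ i])
  finally show ?E .
qed

lemma std_gaussian_second_moment:
  "integrable std_gaussian (\<lambda>x::real^'n. x $ i * x $ j)" (is ?I)
  "(\<integral>x. x $ i * x $ j \<partial>(std_gaussian :: (real^'n) measure)) = of_bool (i = j)" (is ?E)
proof -
  \<comment> \<open>The indicators add up to exponent two when \<open>i = j\<close>, so one formula
    covers both cases: a second moment equal to one, or a factor that is an odd moment and
    vanishes.\<close>
  let ?e = "\<lambda>k. of_bool (k = i) + of_bool (k = j) :: nat"
  have eq: "(\<Prod>k\<in>UNIV. x $ k ^ ?e k) = x $ i * x $ j" for x :: "real^'n"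
  proof -
    have "(\<Prod>k\<in>UNIV. x $ k ^ ?e k)
        = (\<Prod>k\<in>UNIV. (if k = i then x $ k else 1) * (if k = j then x $ k else 1))"
      by (intro prod.cong) auto
    then show ?thesis by (simp add: prod.distrib)
  qed
  show ?I using std_gaussian_moment(1)[of ?e] by (simp only: eq)
  have E: "(\<integral>x. x $ i * x $ j \<partial>std_gaussian) = (\<Prod>k\<in>UNIV. \<integral>t. std_normal_density t * t ^ ?e k \<partial>lborel)"
    using std_gaussian_moment(2)[of ?e] by (simp only: eq)
  show ?E
  proof (cases "i = j")
    case True
    have "(\<integral>t. std_normal_density t * t ^ ?e k \<partial>lborel) = 1" for k
      using integral_std_normal_moment_even[of 0] integral_std_normal_moment_even[of 1] True
      by (cases "k = i") (simp_all add: numeral_2_eq_2 fact_numeral)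
    then show ?thesis using E True by simp
  next
    case False
    have "(\<Prod>k\<in>UNIV. \<integral>t. std_normal_density t * t ^ ?e k \<partial>lborel) = 0"
      using integral_std_normal_moment_odd[of 0] False
      by (intro prod_zero) (auto intro!: bexI[of _ i])
    then show ?thesis using E False by simp
  qed
qed

section \<open>Gaussian densities as affine images of the standard one\<close>

definition gaussian_density :: "real^'n \<Rightarrow> real^'n^'n \<Rightarrow> real^'n \<Rightarrow> real" where
  "gaussian_density m S x =
     exp (- ((x - m) \<bullet> (matrix_inv S *v (x - m))) / 2) / sqrt ((2 * pi) ^ CARD('n) * det S)"

lemma gaussian_eq_density: "gaussian m S = density lborel (\<lambda>x. ennreal (gaussian_density m S x))"
  by (simp add: gaussian_def gaussian_density_def)

lemma borel_measurable_gaussian_density [measurable (raw)]: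
  assumes [measurable]: "f \<in> borel_measurable M" "g \<in> borel_measurable M"
  shows "(\<lambda>x. gaussian_density (f x) S (g x)) \<in> borel_measurable M"
  unfolding gaussian_density_def by measurable

lemma sets_gaussian [simp, measurable_cong]: "sets (gaussian m S) = sets borel"
  and space_gaussian [simp]: "space (gaussian m S) = UNIV"
  by (simp_all add: gaussian_def)

lemma gaussian_density_pos: "pos_def S \<Longrightarrow> 0 < gaussian_density m S x"
  by (simp add: gaussian_density_def pos_def_det_pos)

text \<open>Since \<open>S = Q ** transpose Q\<close>, the matrix
  \<open>transpose Q ** matrix_inv S ** Q\<close> is the identity and the exponent becomes
  \<open>y \<bullet> y\<close>; the absolute value of \<open>det Q\<close> is the square root of
  \<open>det S\<close> and cancels against the normalization.\<close>

lemma gaussian_density_std: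
  fixes Q :: "real^'n^'n"
  assumes Q: "invertible Q" and S: "S = Q ** transpose Q"
  shows "\<bar>det Q\<bar> * gaussian_density m S (m + Q *v y) = (\<Prod>i\<in>UNIV. std_normal_density (y $ i))"
proof -
  have nz: "det Q \<noteq> 0" using Q by (simp add: invertible_det_nz)
  let ?w = "matrix_inv S *v (Q *v y)"
  have "invertible S" using Q by (simp add: S invertible_det_nz det_mul det_transpose)
  then have "S *v ?w = Q *v y" by (rule matrix_inv_vector)
  then have "Q *v (transpose Q *v ?w) = Q *v y"
    by (simp only: S matrix_vector_mul_assoc matrix_mul_assoc)
  then have "transpose Q *v ?w = y"
    using inj_matrix_vector_mult[OF Q] by (simp only: inj_eq)
  then have quad: "(Q *v y) \<bullet> ?w = y \<bullet> y"
    by (metis inner_commute inner_matrix_vector_transpose)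
  have "det S = det Q * det Q" by (simp add: S det_mul det_transpose)
  then have root: "sqrt ((2 * pi) ^ CARD('n) * det S) = sqrt (2 * pi) ^ CARD('n) * \<bar>det Q\<bar>"
    by (simp only: real_sqrt_mult[of _ "det Q * det Q"] real_sqrt_power real_sqrt_abs2)
  have "gaussian_density m S (m + Q *v y) = exp (- (y \<bullet> y) / 2) / (sqrt (2 * pi) ^ CARD('n) * \<bar>det Q\<bar>)"
    unfolding gaussian_density_def by (simp only: add_diff_cancel_left' quad root)
  then have "\<bar>det Q\<bar> * gaussian_density m S (m + Q *v y) = exp (- (y \<bullet> y) / 2) / sqrt (2 * pi) ^ CARD('n)"
    using nz by simp
  also have "\<dots> = (\<Prod>i\<in>UNIV. exp (- (y $ i)\<^sup>2 / 2) / sqrt (2 * pi))"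
    by (simp add: prod_dividef exp_sum[symmetric] inner_vec_def power2_eq_square sum_negf sum_divide_distrib)
  also have "\<dots> = (\<Prod>i\<in>UNIV. std_normal_density (y $ i))"
    by (simp add: std_normal_density_def)
  finally show ?thesis .
qed

text \<open>Source of the total mass and of all moments below. The substitution is a translation by
  \<open>m\<close> followed by the linear map \<open>Q\<close>, whose volume factor
  \<open>gaussian_density_std\<close> absorbs.\<close>

lemma gaussian_eq_distr_std:
  fixes Q :: "real^'n^'n"
  assumes Q: "invertible Q" and S: "S = Q ** transpose Q"
  shows "gaussian m S = distr std_gaussian borel (\<lambda>y. m + Q *v y)"
proof (rule measure_eqI)
  fix A assume "A \<in> sets (gaussian m S)"
  then have [measurable]: "A \<in> sets borel" by simp
  have nz: "det Q \<noteq> 0" using Q by (simp add: invertible_det_nz)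
  let ?g = "\<lambda>x. ennreal (gaussian_density m S x) * indicator A x"
  have "emeasure (gaussian m S) A = (\<integral>\<^sup>+x. ?g x \<partial>lborel)"
    unfolding gaussian_eq_density by (subst emeasure_density) simp_all
  also have "\<dots> = (\<integral>\<^sup>+x. ?g x \<partial>distr lborel borel ((+) m))"
    by (simp only: lborel_distr_plus)
  also have "\<dots> = (\<integral>\<^sup>+x. ?g (m + x) \<partial>lborel)"
    by (subst nn_integral_distr) simp_all
  also have "\<dots> = ennreal \<bar>det Q\<bar> * (\<integral>\<^sup>+y. ?g (m + Q *v y) \<partial>lborel)"
    by (rule nn_integral_lborel_linear[OF nz]) measurable
  also have "\<dots> = (\<integral>\<^sup>+y. ennreal \<bar>det Q\<bar> * ?g (m + Q *v y) \<partial>lborel)"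
    by (subst nn_integral_cmult) simp_all
  also have "\<dots> = (\<integral>\<^sup>+y. ennreal (\<Prod>i\<in>UNIV. std_normal_density (y $ i)) * indicator A (m + Q *v y) \<partial>lborel)"
    unfolding gaussian_density_std[OF Q S, symmetric, where m=m]
    by (simp add: ennreal_mult' mult.assoc)
  also have "\<dots> = emeasure (distr std_gaussian borel (\<lambda>y. m + Q *v y)) A"
    by (subst emeasure_distr, simp_all add: std_gaussian_def)
      (subst emeasure_density, simp_all add: indicator_def vimage_def)
  finally show "emeasure (gaussian m S) A = emeasure (distr std_gaussian borel (\<lambda>y. m + Q *v y)) A" .
qed simp

lemma prob_space_gaussian:
  assumes "pos_def S"
  shows "prob_space (gaussian m S)"
proof -
  interpret prob_space std_gaussian by (rule prob_space_std_gaussian)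
  obtain Q :: "real^'a^'a" where "invertible Q" "S = Q ** transpose Q"
    using assms by (rule pos_def_factor)
  then show ?thesis
    by (simp only: gaussian_eq_distr_std) (rule prob_space_distr, measurable)
qed

lemma nn_integral_gaussian_density:
  assumes "pos_def S"
  shows "(\<integral>\<^sup>+x. ennreal (gaussian_density m S x) \<partial>lborel) = 1"
  using prob_space.emeasure_space_1[OF prob_space_gaussian[OF assms, of m]]
  by (simp add: gaussian_eq_density emeasure_density)

lemma gaussian_centered_moments:
  fixes S :: "real^'n^'n"
  assumes "pos_def S"
  shows "integrable (gaussian m S) (\<lambda>x. x $ i - m $ i)"
    and "(\<integral>x. x $ i - m $ i \<partial>gaussian m S) = 0"
    and "integrable (gaussian m S) (\<lambda>x. (x $ i - m $ i) * (x $ j - m $ j))"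
    and "(\<integral>x. (x $ i - m $ i) * (x $ j - m $ j) \<partial>gaussian m S) = S $ i $ j"
proof -
  obtain Q :: "real^'n^'n" where Q: "invertible Q" and S: "S = Q ** transpose Q"
    using assms by (rule pos_def_factor)
  note distr = gaussian_eq_distr_std[OF Q S, of m]
  have lin: "(m + Q *v y) $ i - m $ i = (\<Sum>k\<in>UNIV. Q $ i $ k * y $ k)" for i y
    by (simp add: matrix_vector_mult_def)
  have quad: "((m + Q *v y) $ i - m $ i) * ((m + Q *v y) $ j - m $ j)
      = (\<Sum>k\<in>UNIV. \<Sum>l\<in>UNIV. Q $ i $ k * Q $ j $ l * (y $ k * y $ l))" for y
    unfolding lin by (simp add: sum_product algebra_simps)
  show "integrable (gaussian m S) (\<lambda>x. x $ i - m $ i)"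
    unfolding distr by (subst integrable_distr_eq) (simp_all only: lin, measurable,
      intro Bochner_Integration.integrable_sum integrable_mult_right std_gaussian_first_moment)
  show "(\<integral>x. x $ i - m $ i \<partial>gaussian m S) = 0"
    unfolding distr
    by (subst integral_distr)
      (simp_all only: lin, measurable, simp add: std_gaussian_first_moment)
  show "integrable (gaussian m S) (\<lambda>x. (x $ i - m $ i) * (x $ j - m $ j))"
    unfolding distr by (subst integrable_distr_eq) (simp_all only: quad, measurable,
      intro Bochner_Integration.integrable_sum integrable_mult_right std_gaussian_second_moment)
  have "(\<integral>x. (x $ i - m $ i) * (x $ j - m $ j) \<partial>gaussian m S)
      = (\<Sum>k\<in>UNIV. \<Sum>l\<in>UNIV. Q $ i $ k * Q $ j $ l * of_bool (k = l))"
    unfolding distr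
    by (subst integral_distr)
      (simp_all only: quad, measurable, simp add: std_gaussian_second_moment)
  also have "\<dots> = S $ i $ j"
    by (simp add: S matrix_matrix_mult_def transpose_def)
  finally show "(\<integral>x. (x $ i - m $ i) * (x $ j - m $ j) \<partial>gaussian m S) = S $ i $ j" .
qed

lemma gaussian_first_moment:
  fixes S :: "real^'n^'n"
  assumes "pos_def S"
  shows "integrable (gaussian m S) (\<lambda>x. x $ i)" "(\<integral>x. x $ i \<partial>gaussian m S) = m $ i"
proof -
  interpret prob_space "gaussian m S" by (rule prob_space_gaussian[OF assms])
  note M = gaussian_centered_moments(1,2)[OF assms, of m i]
  show I: "integrable (gaussian m S) (\<lambda>x. x $ i)"
    using Bochner_Integration.integrable_add[OF M(1) integrable_const[of "m $ i"]] by simp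
  show "(\<integral>x. x $ i \<partial>gaussian m S) = m $ i"
    using M(2) I by (simp add: prob_space[simplified])
qed

lemma gaussian_second_moment:
  fixes S :: "real^'n^'n"
  assumes "pos_def S"
  shows "integrable (gaussian 0 S) (\<lambda>x. x $ i * x $ j)" "(\<integral>x. x $ i * x $ j \<partial>gaussian 0 S) = S $ i $ j"
  using gaussian_centered_moments(3,4)[OF assms, of 0] by simp_all

text \<open>\<open>M \<bullet> S\<close> is the Frobenius inner product, that is, the trace of
  \<open>transpose M ** S\<close>; it arises because the mean of each \<open>x $ i * x $ j\<close>
  is an entry of \<open>S\<close>.\<close>

lemma gaussian_quadratic_form:
  fixes S M :: "real^'n^'n"
  assumes "pos_def S"
  shows "integrable (gaussian 0 S) (\<lambda>x. x \<bullet> (M *v x))" "(\<integral>x. x \<bullet> (M *v x) \<partial>gaussian 0 S) = M \<bullet> S"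
proof -
  have eq: "x \<bullet> (M *v x) = (\<Sum>i\<in>UNIV. \<Sum>j\<in>UNIV. M $ i $ j * (x $ i * x $ j))" for x
    by (simp add: inner_vec_def matrix_vector_mult_def sum_distrib_left algebra_simps)
  show "integrable (gaussian 0 S) (\<lambda>x. x \<bullet> (M *v x))"
    unfolding eq
    by (intro Bochner_Integration.integrable_sum integrable_mult_right gaussian_second_moment assms)
  show "(\<integral>x. x \<bullet> (M *v x) \<partial>gaussian 0 S) = M \<bullet> S"
    unfolding eq by (simp add: gaussian_second_moment assms inner_vec_def)
qed

lemma mean_vec_gaussian:
  fixes S :: "real^'n^'n"
  assumes "pos_def S"
  shows "mean_vec (gaussian m S) = m"
proof -
  have eq: "(\<Sum>i\<in>UNIV. x $ i *\<^sub>R axis i 1) = x" for x :: "real^'n"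
    by (simp add: vec_eq_iff axis_def if_distrib cong: if_cong)
  have "(\<integral>x. x \<partial>gaussian m S) = (\<integral>x. (\<Sum>i\<in>UNIV. x $ i *\<^sub>R axis i 1) \<partial>gaussian m S)"
    by (simp only: eq)
  also have "\<dots> = (\<Sum>i\<in>UNIV. m $ i *\<^sub>R axis i 1)"
    by (subst Bochner_Integration.integral_sum)
      (simp_all add: gaussian_first_moment assms)
  finally show ?thesis by (simp add: mean_vec_def eq)
qed

lemma cov_mat_gaussian: "pos_def S \<Longrightarrow> cov_mat (gaussian m S) = S"
  by (simp add: cov_mat_def mean_vec_gaussian gaussian_centered_moments vec_eq_iff)

section \<open>Dependence on the mean, and exponential tilting\<close>

lemma gaussian_eq_distr_translation:
  assumes "pos_def S"
  shows "gaussian m S = distr (gaussian 0 S) borel ((+) m)"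
proof -
  obtain Q :: "real^'a^'a" where "invertible Q" "S = Q ** transpose Q"
    using assms by (rule pos_def_factor)
  then show ?thesis
    by (simp add: gaussian_eq_distr_std distr_distr o_def)
qed

text \<open>The kernel pushes one fixed probability measure forward under a translation that depends
  measurably on the parameter.\<close>

lemma measurable_gaussian_prob_algebra:
  assumes S: "pos_def S" and [measurable]: "f \<in> borel_measurable M"
  shows "(\<lambda>v. gaussian (f v) S) \<in> M \<rightarrow>\<^sub>M prob_algebra borel"
proof -
  have [measurable]: "(\<lambda>_. gaussian 0 S) \<in> M \<rightarrow>\<^sub>M prob_algebra borel"
    using prob_space_gaussian[OF S] by (intro measurable_const) (simp add: space_prob_algebra)
  show ?thesis
    by (subst gaussian_eq_distr_translation[OF S]) measurable
qed

text \<open>A linear tilt leaves the quadratic part of the exponent alone, so the covariance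
  survives. The leftover constant \<open>exp (a \<bullet> (S *v a) / 2)\<close> is the moment
  generating function at \<open>a\<close>.\<close>

lemma gaussian_density_exp_inner:
  assumes S: "pos_def S"
  shows "gaussian_density 0 S x * exp (a \<bullet> x)
    = exp (a \<bullet> (S *v a) / 2) * gaussian_density (S *v a) S x"
proof -
  note inv = pos_def_invertible[OF S]
  have sym: "transpose (matrix_inv S) = matrix_inv S"
    using S pos_def_matrix_inv by (auto simp: pos_def_def)
  let ?P = "matrix_inv S"
  have "(x - S *v a) \<bullet> (?P *v (x - S *v a)) = x \<bullet> (?P *v x) - 2 * (a \<bullet> x) + a \<bullet> (S *v a)"
    using inner_symmetric_matrix[OF sym, of "S *v a" x]
    by (simp add: matrix_vector_mult_diff_distrib matrix_inv_vector inv inner_diff inner_commute)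
  then have "- (x \<bullet> (?P *v x)) / 2 + a \<bullet> x
      = a \<bullet> (S *v a) / 2 + - ((x - S *v a) \<bullet> (?P *v (x - S *v a))) / 2"
    by (simp add: field_simps)
  then have "exp (- (x \<bullet> (?P *v x)) / 2) * exp (a \<bullet> x)
      = exp (a \<bullet> (S *v a) / 2) * exp (- ((x - S *v a) \<bullet> (?P *v (x - S *v a))) / 2)"
    unfolding exp_add[symmetric] by (rule arg_cong)
  then show ?thesis by (simp add: gaussian_density_def)
qed

lemma gaussian_exponential_moment:
  assumes S: "pos_def S"
  shows "(\<integral>\<^sup>+x. ennreal (exp (a \<bullet> x)) \<partial>gaussian 0 S) = ennreal (exp (a \<bullet> (S *v a) / 2))"
    and "(\<integral>x. exp (a \<bullet> x) \<partial>gaussian 0 S) = exp (a \<bullet> (S *v a) / 2)"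
proof -
  have "(\<integral>\<^sup>+x. ennreal (exp (a \<bullet> x)) \<partial>gaussian 0 S)
      = (\<integral>\<^sup>+x. ennreal (gaussian_density 0 S x * exp (a \<bullet> x)) \<partial>lborel)"
    unfolding gaussian_eq_density using gaussian_density_pos[OF S]
    by (subst nn_integral_density) (simp_all add: ennreal_mult less_imp_le)
  also have "\<dots> = (\<integral>\<^sup>+x. ennreal (exp (a \<bullet> (S *v a) / 2)) * ennreal (gaussian_density (S *v a) S x) \<partial>lborel)"
    unfolding gaussian_density_exp_inner[OF S]
    by (simp add: ennreal_mult')
  also have "\<dots> = ennreal (exp (a \<bullet> (S *v a) / 2))"
    by (subst nn_integral_cmult) (simp_all add: nn_integral_gaussian_density S)
  finally show E: "(\<integral>\<^sup>+x. ennreal (exp (a \<bullet> x)) \<partial>gaussian 0 S) = ennreal (exp (a \<bullet> (S *v a) / 2))" .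
  show "(\<integral>x. exp (a \<bullet> x) \<partial>gaussian 0 S) = exp (a \<bullet> (S *v a) / 2)"
    by (subst integral_eq_nn_integral) (simp_all add: E)
qed

section \<open>Conditional laws from joint densities\<close>

text \<open>For a fixed \<open>S\<close>, the two functions of \<open>y\<close> have equal integrals
  over every \<open>T\<close>, so they agree almost everywhere. The exceptional null set depends on
  \<open>S\<close>; hence the passage to a countable generator closed under intersections, on which
  all null sets can be united.\<close>

lemma conditional_kernel_unique:
  fixes X :: "'a \<Rightarrow> 'b::second_countable_topology" and Y :: "'a \<Rightarrow> 'c::topological_space"
  assumes "prob_space M" and Y [measurable]: "Y \<in> M \<rightarrow>\<^sub>M borel"
    and K: "conditional_kernel M X Y K" and L: "conditional_kernel M X Y L"
  shows "AE y in distr M borel Y. L y = K y"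
proof -
  interpret prob_space M by fact
  interpret D: prob_space "distr M borel Y" by (rule prob_space_distr) simp
  obtain B :: "'b set set" where B: "countable B" "topological_basis B"
    using ex_countable_basis by blast
  \<comment> \<open>Finite intersections make the countable base stable under intersection. The
    empty family is included on purpose: its intersection is \<open>UNIV\<close>, which later serves
    as the exhausting sequence.\<close>
  define E where "E = Inter ` {F. finite F \<and> F \<subseteq> B}"
  have E_countable: "countable E"
    unfolding E_def by (intro countable_image countable_Collect_finite_subset B)
  have E_open: "open S" if "S \<in> E" for S
    using that topological_basis_open[OF B(2)] by (auto simp: E_def intro!: open_Inter)
  have E_Int: "Int_stable E"
  proof (rule Int_stableI)
    fix S T assume "S \<in> E" "T \<in> E"
    then obtain F G where "S = \<Inter>F" "T = \<Inter>G" "finite F" "finite G" "F \<subseteq> B" "G \<subseteq> B"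
      by (auto simp: E_def)
    then show "S \<inter> T \<in> E"
      unfolding E_def by (intro image_eqI[of _ _ "F \<union> G"]) auto
  qed
  have E_UNIV: "UNIV \<in> E"
    unfolding E_def by (intro image_eqI[of _ _ "{}"]) auto
  have E_sets: "sigma_sets UNIV E = sets borel"
  proof
    show "sigma_sets UNIV E \<subseteq> sets borel"
      using sets.sigma_sets_subset[of E borel] E_open borel_open by (metis space_borel subsetI)
    have "B \<subseteq> E"
    proof
      fix b assume "b \<in> B"
      then show "b \<in> E" unfolding E_def by (intro image_eqI[of _ _ "{b}"]) auto
    qed
    then show "sets borel \<subseteq> sigma_sets UNIV E"
      unfolding borel_eq_countable_basis[OF B] by (auto intro: sigma_sets_mono' [THEN subsetD])
  qed
  have prob: "sets (J y) = sets borel \<and> prob_space (J y)" if "conditional_kernel M X Y J" for J y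
    using that measurable_space[of J borel "prob_algebra borel" y]
    by (auto simp: conditional_kernel_def space_prob_algebra)
  have meas: "(\<lambda>y. emeasure (J y) S) \<in> borel_measurable (distr M borel Y)"
    if "conditional_kernel M X Y J" "S \<in> sets borel" for J S
    using that measurable_emeasure_subprob_algebra[of S borel]
    by (auto simp: conditional_kernel_def dest!: measurable_prob_algebraD intro: measurable_compose)
  have "AE y in distr M borel Y. emeasure (L y) S = emeasure (K y) S" if "S \<in> E" for S
  proof (rule D.density_unique2)
    have S: "S \<in> sets borel" using E_open[OF that] by simp
    show "(\<lambda>y. emeasure (L y) S) \<in> borel_measurable (distr M borel Y)"
      "(\<lambda>y. emeasure (K y) S) \<in> borel_measurable (distr M borel Y)"
      using meas K L S by auto
    have rect: "(\<integral>\<^sup>+y\<in>T. emeasure (J y) S \<partial>distr M borel Y) = emeasure M {\<omega> \<in> space M. X \<omega> \<in> S \<and> Y \<omega> \<in> T}"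
      if "conditional_kernel M X Y J" "T \<in> sets borel" for J T
      using that S unfolding conditional_kernel_def by (elim conjE) (drule (1) bspec, drule (1) bspec, erule sym)
    show "(\<integral>\<^sup>+y\<in>T. emeasure (L y) S \<partial>distr M borel Y) = (\<integral>\<^sup>+y\<in>T. emeasure (K y) S \<partial>distr M borel Y)"
      if "T \<in> sets (distr M borel Y)" for T
      using rect[OF K, of T] rect[OF L, of T] that by simp
  qed
  then have "AE y in distr M borel Y. \<forall>S\<in>E. emeasure (L y) S = emeasure (K y) S"
    using E_countable by (subst AE_ball_countable) auto
  then show ?thesis
  proof (eventually_elim)
    fix y assume eq: "\<forall>S\<in>E. emeasure (L y) S = emeasure (K y) S"
    show "L y = K y"
    proof (rule measure_eqI_generator_eq[OF E_Int, where A="\<lambda>_. UNIV" and \<Omega>=UNIV])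
      show "emeasure (L y) UNIV \<noteq> \<infinity>" for i :: nat
        using prob[OF L, of y] prob_space.emeasure_le_1[of "L y" UNIV] by (auto simp: top_unique)
    qed (use eq E_UNIV E_sets prob[OF L, of y] prob[OF K, of y] in auto)
  qed
qed

text \<open>Each \<open>K y\<close> has mass one, so rectangles with \<open>S = UNIV\<close> reveal
  \<open>density N h\<close> as the law of \<open>Y\<close>. The marginal is thus an output:
  \<open>h\<close> does not have to be recognized beforehand.\<close>

lemma conditional_law_density:
  fixes X :: "'a \<Rightarrow> 'b::second_countable_topology" and Y :: "'a \<Rightarrow> 'c::topological_space"
  assumes M: "prob_space M" and [measurable]: "X \<in> M \<rightarrow>\<^sub>M borel" "Y \<in> M \<rightarrow>\<^sub>M borel"
    and K: "K \<in> borel \<rightarrow>\<^sub>M prob_algebra borel"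
    and N: "sets N = sets borel" and h: "h \<in> borel_measurable borel"
    and rect: "\<And>S T. S \<in> sets borel \<Longrightarrow> T \<in> sets borel \<Longrightarrow>
      emeasure M {\<omega> \<in> space M. X \<omega> \<in> S \<and> Y \<omega> \<in> T} = (\<integral>\<^sup>+y\<in>T. h y * emeasure (K y) S \<partial>N)"
  shows "distr M borel Y = density N h" and "conditional_law M X Y K"
proof -
  have [measurable_cong]: "sets N = sets borel" by fact
  note [measurable] = h
  have prob: "sets (K y) = sets borel \<and> prob_space (K y)" for y
    using measurable_space[OF K, of y] by (simp add: space_prob_algebra)
  have one: "emeasure (K y) UNIV = 1" for y
    using prob[of y] prob_space.emeasure_space_1[of "K y"] sets_eq_imp_space_eq[of "K y" borel] by simp
  have [measurable]: "(\<lambda>y. emeasure (K y) S) \<in> borel_measurable borel" if "S \<in> sets borel" for S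
    using measurable_compose[OF measurable_prob_algebraD[OF K] measurable_emeasure_subprob_algebra[OF that]] .
  show D: "distr M borel Y = density N h"
  proof (rule measure_eqI)
    fix T assume "T \<in> sets (distr M borel Y)"
    then have T [measurable]: "T \<in> sets borel" by simp
    have "emeasure (distr M borel Y) T = emeasure M {\<omega> \<in> space M. X \<omega> \<in> UNIV \<and> Y \<omega> \<in> T}"
      by (subst emeasure_distr) (auto intro!: arg_cong[where f="emeasure M"])
    also have "\<dots> = (\<integral>\<^sup>+y\<in>T. h y * emeasure (K y) UNIV \<partial>N)"
      using T by (intro rect) auto
    also have "\<dots> = emeasure (density N h) T"
      by (subst emeasure_density) (simp_all add: one)
    finally show "emeasure (distr M borel Y) T = emeasure (density N h) T" .
  qed (simp add: N)
  have "conditional_kernel M X Y K"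
    unfolding conditional_kernel_def D
  proof (intro conjI ballI K)
    fix S :: "'b set" and T :: "'c set" assume S [measurable]: "S \<in> sets borel" and T [measurable]: "T \<in> sets borel"
    show "emeasure M {\<omega> \<in> space M. X \<omega> \<in> S \<and> Y \<omega> \<in> T} = (\<integral>\<^sup>+y\<in>T. emeasure (K y) S \<partial>density N h)"
      unfolding rect[OF S T] by (subst nn_integral_density) (simp_all add: mult.assoc)
  qed
  then show "conditional_law M X Y K"
    unfolding conditional_law_def using conditional_kernel_unique[OF M, of Y X K] by simp
qed

lemma nn_integral_density_rectangle:
  assumes [measurable]: "k \<in> borel_measurable borel" "S \<in> sets borel"
  shows "(\<integral>\<^sup>+u. a * k u * (indicator S u * b) \<partial>lborel) = a * emeasure (density lborel k) S * b"
proof -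
  have "(\<integral>\<^sup>+u. a * k u * (indicator S u * b) \<partial>lborel) = (\<integral>\<^sup>+u. (a * b) * (k u * indicator S u) \<partial>lborel)"
    by (simp add: ac_simps)
  also have "\<dots> = a * b * emeasure (density lborel k) S"
    by (subst nn_integral_cmult) (simp_all add: emeasure_density)
  finally show ?thesis by (simp add: ac_simps)
qed

text \<open>Splitting off a factor in \<open>v\<close> alone that leaves a probability density in
  \<open>u\<close> is already a disintegration. This serves \<mu> and \<nu> alike.\<close>

lemma conditional_law_fst_snd:
  fixes k :: "'c::euclidean_space \<Rightarrow> 'b::euclidean_space \<Rightarrow> ennreal"
  assumes M: "prob_space M"
    and h [measurable]: "h \<in> borel_measurable borel"
    and k [measurable]: "(\<lambda>(u, v). k v u) \<in> borel_measurable (borel \<Otimes>\<^sub>M borel)"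
    and K: "(\<lambda>v. density lborel (k v)) \<in> borel \<rightarrow>\<^sub>M prob_algebra borel"
    and M_eq: "M = density (lborel \<Otimes>\<^sub>M lborel) (\<lambda>(u, v). h v * k v u)"
  shows "distr M borel snd = density lborel h"
    and "conditional_law M fst snd (\<lambda>v. density lborel (k v))"
proof -
  have kv [measurable]: "k v \<in> borel_measurable borel" for v
    using measurable_compose[OF measurable_Pair2'[of v borel borel] k] by simp
  have sp [simp]: "space M = UNIV" and [measurable_cong]: "sets M = sets (borel \<Otimes>\<^sub>M borel)"
    by (simp_all add: M_eq space_pair_measure cong: sets_pair_measure_cong)
  have rect: "emeasure M {\<omega> \<in> space M. fst \<omega> \<in> S \<and> snd \<omega> \<in> T}
      = (\<integral>\<^sup>+v\<in>T. h v * emeasure (density lborel (k v)) S \<partial>lborel)"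
    if [measurable]: "S \<in> sets borel" "T \<in> sets borel" for S T
  proof -
    have "{\<omega> \<in> space M. fst \<omega> \<in> S \<and> snd \<omega> \<in> T} = S \<times> T" by auto
    then have "emeasure M {\<omega> \<in> space M. fst \<omega> \<in> S \<and> snd \<omega> \<in> T}
        = (\<integral>\<^sup>+(u, v). h v * k v u * (indicator S u * indicator T v) \<partial>(lborel \<Otimes>\<^sub>M lborel))"
      unfolding M_eq
      by (simp add: emeasure_density split_beta' indicator_times)
    also have "\<dots> = (\<integral>\<^sup>+v. \<integral>\<^sup>+u. h v * k v u * (indicator S u * indicator T v) \<partial>lborel \<partial>lborel)"
      by (subst lborel_pair.nn_integral_snd[symmetric]) (simp_all, measurable)
    finally show ?thesis by (simp add: nn_integral_density_rectangle)
  qed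
  note cl = conditional_law_density[OF M _ _ K sets_lborel h rect]
  show "distr M borel snd = density lborel h"
    by (rule cl(1)) simp_all
  show "conditional_law M fst snd (\<lambda>v. density lborel (k v))"
    by (rule cl(2)) simp_all
qed

lemma conditional_law_snd_fst:
  fixes k :: "'b::euclidean_space \<Rightarrow> 'c::euclidean_space \<Rightarrow> ennreal"
  assumes M: "prob_space M"
    and h [measurable]: "h \<in> borel_measurable borel"
    and k [measurable]: "(\<lambda>(u, v). k u v) \<in> borel_measurable (borel \<Otimes>\<^sub>M borel)"
    and K: "(\<lambda>u. density lborel (k u)) \<in> borel \<rightarrow>\<^sub>M prob_algebra borel"
    and M_eq: "M = density (lborel \<Otimes>\<^sub>M lborel) (\<lambda>(u, v). h u * k u v)"
  shows "distr M borel fst = density lborel h"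
    and "conditional_law M snd fst (\<lambda>u. density lborel (k u))"
proof -
  have ku [measurable]: "k u \<in> borel_measurable borel" for u
    using measurable_compose[OF measurable_Pair1'[of u borel borel] k] by simp
  have sp [simp]: "space M = UNIV" and [measurable_cong]: "sets M = sets (borel \<Otimes>\<^sub>M borel)"
    by (simp_all add: M_eq space_pair_measure cong: sets_pair_measure_cong)
  have rect: "emeasure M {\<omega> \<in> space M. snd \<omega> \<in> S \<and> fst \<omega> \<in> T}
      = (\<integral>\<^sup>+u\<in>T. h u * emeasure (density lborel (k u)) S \<partial>lborel)"
    if [measurable]: "S \<in> sets borel" "T \<in> sets borel" for S T
  proof -
    have "{\<omega> \<in> space M. snd \<omega> \<in> S \<and> fst \<omega> \<in> T} = T \<times> S" by auto
    then have "emeasure M {\<omega> \<in> space M. snd \<omega> \<in> S \<and> fst \<omega> \<in> T}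
        = (\<integral>\<^sup>+(u, v). h u * k u v * (indicator S v * indicator T u) \<partial>(lborel \<Otimes>\<^sub>M lborel))"
      unfolding M_eq
      by (simp add: emeasure_density split_beta' indicator_times mult.commute)
    also have "\<dots> = (\<integral>\<^sup>+u. \<integral>\<^sup>+v. h u * k u v * (indicator S v * indicator T u) \<partial>lborel \<partial>lborel)"
      by (subst lborel.nn_integral_fst[symmetric]) (simp_all, measurable)
    finally show ?thesis by (simp add: nn_integral_density_rectangle)
  qed
  note cl = conditional_law_density[OF M _ _ K sets_lborel h rect]
  show "distr M borel fst = density lborel h"
    by (rule cl(1)) simp_all
  show "conditional_law M snd fst (\<lambda>u. density lborel (k u))"
    by (rule cl(2)) simp_all
qed

section \<open>Block matrices and the joint Gaussian\<close>

text \<open>Products with a transposed matrix are to stay in the form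
  \<open>transpose b *v x\<close>, to which \<open>matrix_vector_mul_assoc\<close> applies, rather
  than turn into row-vector products.\<close>

declare transpose_matrix_vector [simp del]

lemma sum_UNIV_Plus:
  fixes f :: "'m::finite + 'n::finite \<Rightarrow> 'a::comm_monoid_add"
  shows "(\<Sum>k\<in>UNIV. f k) = (\<Sum>i\<in>UNIV. f (Inl i)) + (\<Sum>j\<in>UNIV. f (Inr j))"
  by (subst UNIV_Plus_UNIV[symmetric], subst sum.Plus) (simp_all add: o_def)

lemma prod_UNIV_Plus:
  fixes f :: "'m::finite + 'n::finite \<Rightarrow> 'a::comm_monoid_mult"
  shows "(\<Prod>k\<in>UNIV. f k) = (\<Prod>i\<in>UNIV. f (Inl i)) * (\<Prod>j\<in>UNIV. f (Inr j))"
  by (subst UNIV_Plus_UNIV[symmetric], subst prod.Plus) (simp_all add: o_def)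

definition join_vec :: "real^'m \<Rightarrow> real^'n \<Rightarrow> real^('m::finite + 'n::finite)" where
  "join_vec u v = (\<chi> k. case k of Inl i \<Rightarrow> u $ i | Inr j \<Rightarrow> v $ j)"

lemma join_vec_nth [simp]: "join_vec u v $ Inl i = u $ i" "join_vec u v $ Inr j = v $ j"
  by (simp_all add: join_vec_def)

lemma split_join_vec [simp]: "split_vec (join_vec u v) = (u, v)"
  by (simp add: split_vec_def vec_eq_iff)

lemma vec_eq_Plus_iff:
  "x = y \<longleftrightarrow> (\<forall>i. x $ Inl i = y $ Inl i) \<and> (\<forall>j. x $ Inr j = y $ Inr j)"
  by (auto simp: vec_eq_iff split: sum.split) (metis sum.exhaust)

lemma join_split_vec [simp]: "join_vec (fst (split_vec x)) (snd (split_vec x)) = x"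
  by (simp add: split_vec_def vec_eq_Plus_iff)

lemma join_vec_eq_0_iff: "join_vec u v = 0 \<longleftrightarrow> u = 0 \<and> v = 0"
  by (simp add: vec_eq_Plus_iff) (simp add: vec_eq_iff)

lemma inner_join_vec: "join_vec u v \<bullet> join_vec u' v' = u \<bullet> u' + v \<bullet> v'"
  by (simp add: inner_vec_def sum_UNIV_Plus)

lemma matrix_vector_mult_join_vec:
  "C *v join_vec u v = join_vec (block_uu C *v u + block_uv C *v v) (block_vu C *v u + block_vv C *v v)"
  by (simp add: vec_eq_Plus_iff)
    (simp add: matrix_vector_mult_def sum_UNIV_Plus block_uu_def block_uv_def block_vu_def block_vv_def)

lemma borel_measurable_join_vec [measurable (raw)]:
  assumes [measurable]: "f \<in> borel_measurable M" "g \<in> borel_measurable M"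
  shows "(\<lambda>x. join_vec (f x) (g x)) \<in> borel_measurable M"
proof -
  have "(\<lambda>x. case k of Inl i \<Rightarrow> f x $ i | Inr j \<Rightarrow> g x $ j) \<in> borel_measurable M" for k
    by (cases k) simp_all
  then show ?thesis unfolding join_vec_def by measurable
qed

lemma borel_measurable_split_vec [measurable]: "split_vec \<in> borel_measurable borel"
  unfolding split_vec_def by measurable

text \<open>Splitting the coordinates carries boxes to boxes of equal volume. It is what turns a
  density over the sum index type into a density on the product space.\<close>

lemma distr_lborel_split_vec:
  "distr lborel borel split_vec = (lborel :: ((real^'m::finite) \<times> (real^'n::finite)) measure)"
proof (rule lborel_eqI[symmetric])
  fix l u :: "(real^'m) \<times> (real^'n)"
  assume le: "\<And>b. b \<in> Basis \<Longrightarrow> l \<bullet> b \<le> u \<bullet> b"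
  obtain l1 l2 u1 u2 where lu: "l = (l1, l2)" "u = (u1, u2)" by (cases l, cases u)
  have le1: "l1 $ i \<le> u1 $ i" for i
    using le[of "(axis i 1, 0)"] by (simp add: lu inner_axis Basis_prod_def axis_in_Basis_iff)
  have le2: "l2 $ j \<le> u2 $ j" for j
    using le[of "(0, axis j 1)"] by (simp add: lu inner_axis Basis_prod_def axis_in_Basis_iff)
  have mem: "split_vec x \<in> box l u \<longleftrightarrow> x \<in> box (join_vec l1 l2) (join_vec u1 u2)" for x
  proof -
    have "split_vec x \<in> box l u
        \<longleftrightarrow> fst (split_vec x) \<in> box l1 u1 \<and> snd (split_vec x) \<in> box l2 u2"
      by (auto simp: lu mem_box Basis_prod_def ball_Un inner_prod_def)
    then show ?thesis
      by (simp add: split_vec_def mem_box_cart split_sum_all)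
  qed
  have le': "join_vec l1 l2 \<bullet> b \<le> join_vec u1 u2 \<bullet> b" if *: "b \<in> Basis" for b
  proof -
    obtain k where b: "b = axis k 1" using * by (auto simp: Basis_vec_def)
    show ?thesis by (cases k) (simp_all add: b inner_axis le1 le2)
  qed
  have "(\<Prod>b\<in>Basis. (u - l) \<bullet> b) = (\<Prod>b\<in>Basis. (u1 - l1) \<bullet> b) * (\<Prod>b\<in>Basis. (u2 - l2) \<bullet> b)"
    unfolding Basis_prod_def lu
    by (subst prod.union_disjoint) (auto simp: prod.reindex inj_on_def)
  also have "\<dots> = (\<Prod>i\<in>UNIV. u1 $ i - l1 $ i) * (\<Prod>j\<in>UNIV. u2 $ j - l2 $ j)"
    by (simp add: prod_Basis_vec inner_axis)
  also have "\<dots> = (\<Prod>b\<in>Basis. (join_vec u1 u2 - join_vec l1 l2) \<bullet> b)"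
    by (simp add: prod_Basis_vec inner_axis prod_UNIV_Plus)
  finally show "emeasure (distr lborel borel split_vec) (box l u) = ennreal (\<Prod>b\<in>Basis. (u - l) \<bullet> b)"
    by (subst emeasure_distr) (simp_all add: mem vimage_def emeasure_lborel_box[OF le'])
qed simp

lemma joint_gaussian_eq_density:
  "joint_gaussian C
    = density (lborel \<Otimes>\<^sub>M lborel) (\<lambda>(u, v). ennreal (gaussian_density 0 C (join_vec u v)))"
proof -
  \<comment> \<open>The density is first written as a function of \<open>split_vec x\<close>, the
    shape that \<open>density_distr\<close> can push forward.\<close>
  have "joint_gaussian C
      = distr (density lborel (\<lambda>x. ennreal (gaussian_density 0 C
          (join_vec (fst (split_vec x)) (snd (split_vec x)))))) borel split_vec"
    by (simp add: joint_gaussian_def gaussian_eq_density)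
  also have "\<dots> = density (distr lborel borel split_vec)
      (\<lambda>w. ennreal (gaussian_density 0 C (join_vec (fst w) (snd w))))"
  proof (rule density_distr[symmetric])
    have [measurable]: "fst \<in> borel_measurable (borel :: ((real^'a) \<times> (real^'b)) measure)"
      "snd \<in> borel_measurable (borel :: ((real^'a) \<times> (real^'b)) measure)"
      by (auto intro!: borel_measurable_continuous_onI continuous_intros)
    show "(\<lambda>w. ennreal (gaussian_density 0 C (join_vec (fst w) (snd w)))) \<in> borel_measurable borel"
      by measurable
  qed measurable
  finally show ?thesis
    by (simp add: distr_lborel_split_vec lborel_prod split_beta')
qed

text \<open>The blocks of a positive definite matrix, with no reference to the matrix: unlike the matrix,
  this condition is symmetric in the two blocks.\<close>

definition pos_def_blocks :: "real^'m^'m \<Rightarrow> real^'n^'m \<Rightarrow> real^'n^'n \<Rightarrow> bool" where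
  "pos_def_blocks a b d \<longleftrightarrow> transpose a = a \<and> transpose d = d \<and>
     (\<forall>u v. u \<noteq> 0 \<or> v \<noteq> 0 \<longrightarrow> 0 < u \<bullet> (a *v u) + 2 * (u \<bullet> (b *v v)) + v \<bullet> (d *v v))"

text \<open>Through this exchange each fact about \<open>u\<close> given \<open>v\<close> yields its
  mirror image.\<close>

lemma pos_def_blocks_swap:
  assumes "pos_def_blocks a b d"
  shows "pos_def_blocks d (transpose b) a"
proof -
  have "v \<bullet> (transpose b *v u) = u \<bullet> (b *v v)" for u v
    using inner_matrix_vector_transpose[of u b v] by (simp add: inner_commute)
  then show ?thesis
    using assms by (auto simp: pos_def_blocks_def add_ac)
qed

lemma pos_def_blocksD:
  assumes "pos_def_blocks a b d"
  shows "pos_def a"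
  using assms unfolding pos_def_blocks_def pos_def_def
  by (metis add.right_neutral inner_zero_left inner_zero_right matrix_vector_mult_0_right mult_zero_right)

lemma pos_def_imp_blocks:
  assumes "pos_def C"
  shows "block_vu C = transpose (block_uv C)"
    and "pos_def_blocks (block_uu C) (block_uv C) (block_vv C)"
proof -
  have "transpose C $ j $ i = C $ j $ i" for i j
    using assms by (simp add: pos_def_def)
  then have sym: "C $ i $ j = C $ j $ i" for i j
    by (simp add: transpose_def)
  show vu: "block_vu C = transpose (block_uv C)"
    by (simp add: block_vu_def block_uv_def transpose_def vec_eq_iff sym)
  show "pos_def_blocks (block_uu C) (block_uv C) (block_vv C)"
    unfolding pos_def_blocks_def
  proof (intro conjI allI impI)
    show "transpose (block_uu C) = block_uu C" "transpose (block_vv C) = block_vv C"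
      by (simp_all add: block_uu_def block_vv_def transpose_def vec_eq_iff sym)
    fix u v assume "u \<noteq> (0 :: real^'a) \<or> v \<noteq> (0 :: real^'b)"
    then have "join_vec u v \<noteq> 0" by (simp add: join_vec_eq_0_iff)
    then have "0 < join_vec u v \<bullet> (C *v join_vec u v)"
      using assms by (simp add: pos_def_def)
    moreover have "v \<bullet> (block_vu C *v u) = u \<bullet> (block_uv C *v v)"
      unfolding vu using inner_matrix_vector_transpose[of u "block_uv C" v] by (simp add: inner_commute)
    ultimately show "0 < u \<bullet> (block_uu C *v u) + 2 * (u \<bullet> (block_uv C *v v)) + v \<bullet> (block_vv C *v v)"
      by (simp add: matrix_vector_mult_join_vec inner_join_vec inner_add_right)
  qed
qed

text \<open>For the blocks of a covariance this is the conditional covariance of \<open>u\<close>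
  given \<open>v\<close>, and \<open>schur d (transpose b) a\<close> is that of \<open>v\<close>
  given \<open>u\<close>.\<close>

definition schur :: "real^'m^'m \<Rightarrow> real^'n^'m \<Rightarrow> real^'n^'n \<Rightarrow> real^'m^'m" where
  "schur a b d = a - b ** matrix_inv d ** transpose b"

lemma schur_vector: "schur a b d *v p = a *v p - b *v (matrix_inv d *v (transpose b *v p))"
  by (simp add: schur_def matrix_vector_mult_diff_rdistrib matrix_vector_mul_assoc matrix_mul_assoc)

lemma pos_def_schur:
  assumes B: "pos_def_blocks a b d"
  shows "pos_def (schur a b d)"
  unfolding pos_def_def
proof (intro conjI allI impI)
  have d: "pos_def d" using pos_def_blocksD[OF pos_def_blocks_swap[OF B]] .
  note inv = pos_def_invertible[OF d]
  have "transpose (matrix_inv d) = matrix_inv d"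
    using pos_def_matrix_inv[OF d] by (simp add: pos_def_def)
  moreover have "transpose (x - y) = transpose x - transpose y" for x y :: "real^'a^'a"
    by (simp add: transpose_def vec_eq_iff)
  ultimately show "transpose (schur a b d) = schur a b d"
    using B by (simp add: schur_def pos_def_blocks_def matrix_transpose_mul matrix_mul_assoc)
  fix p :: "real^'a" assume "p \<noteq> 0"
  let ?q = "matrix_inv d *v (transpose b *v p)"
  \<comment> \<open>For fixed \<open>p\<close> the choice \<open>- ?q\<close> minimizes the block
    form in its second argument, and the minimum is the form of the Schur complement at
    \<open>p\<close>.\<close>
  have "0 < p \<bullet> (a *v p) + 2 * (p \<bullet> (b *v (- ?q))) + (- ?q) \<bullet> (d *v (- ?q))"
    using B \<open>p \<noteq> 0\<close> unfolding pos_def_blocks_def by blast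
  also have "\<dots> = p \<bullet> (a *v p) - 2 * (p \<bullet> (b *v ?q)) + ?q \<bullet> (transpose b *v p)"
    by (simp add: matrix_inv_vector inv linear_neg[OF matrix_vector_mul_linear]) 
  also have "?q \<bullet> (transpose b *v p) = p \<bullet> (b *v ?q)"
    using inner_matrix_vector_transpose[of p b ?q] by (simp add: inner_commute)
  finally show "0 < p \<bullet> (schur a b d *v p)"
    by (simp add: schur_vector inner_diff_right)
qed

text \<open>Block elimination with \<open>(p, q)\<close> as the preimage of \<open>(u, v)\<close>,
  which avoids any formula for the inverse of a block matrix: subtracting
  \<open>b ** matrix_inv d\<close> times the second equation from the first leaves
  \<open>w = schur a b d *v p\<close>.\<close>

lemma blocks_quadratic_form:
  assumes B: "pos_def_blocks a b d"
    and u: "u = a *v p + b *v q" and v: "v = transpose b *v p + d *v q"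
  defines "w \<equiv> u - b *v (matrix_inv d *v v)"
  shows "u \<bullet> p + v \<bullet> q = v \<bullet> (matrix_inv d *v v) + w \<bullet> (matrix_inv (schur a b d) *v w)"
proof -
  have d: "pos_def d" using pos_def_blocksD[OF pos_def_blocks_swap[OF B]] .
  note inv = pos_def_invertible[OF d]
  have q: "matrix_inv d *v v = matrix_inv d *v (transpose b *v p) + q"
    by (simp add: v matrix_vector_right_distrib matrix_inv_vector inv)
  have "w = schur a b d *v p"
    by (simp add: w_def u q schur_vector matrix_vector_right_distrib)
  then have p: "matrix_inv (schur a b d) *v w = p"
    using matrix_inv_vector(2)[OF pos_def_invertible[OF pos_def_schur[OF B]]] by simp
  have sym: "transpose (matrix_inv d) = matrix_inv d"
    using pos_def_matrix_inv[OF d] by (simp add: pos_def_def)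
  have "(b *v (matrix_inv d *v v)) \<bullet> p = v \<bullet> (matrix_inv d *v (transpose b *v p))"
    using inner_matrix_vector_transpose[of p b "matrix_inv d *v v"]
      inner_symmetric_matrix[OF sym, of v "transpose b *v p"] by (simp add: inner_commute)
  then show ?thesis
    unfolding p by (simp add: w_def inner_diff_left q inner_add_right)
qed

section \<open>Factorization of the joint Gaussian density\<close>

lemma prob_space_joint_gaussian:
  assumes "pos_def C"
  shows "prob_space (joint_gaussian C)"
proof -
  interpret prob_space "gaussian 0 C" by (rule prob_space_gaussian[OF assms])
  show ?thesis
    unfolding joint_gaussian_def by (rule prob_space_distr) measurable
qed

lemma quadratic_form_join_vec:
  assumes C: "pos_def C"
  defines "a \<equiv> block_uu C" and "b \<equiv> block_uv C" and "d \<equiv> block_vv C"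
  shows "join_vec u v \<bullet> (matrix_inv C *v join_vec u v)
      = v \<bullet> (matrix_inv d *v v) + (u - (b ** matrix_inv d) *v v)
          \<bullet> (matrix_inv (schur a b d) *v (u - (b ** matrix_inv d) *v v))" (is "?Q = ?R1")
    and "join_vec u v \<bullet> (matrix_inv C *v join_vec u v)
      = u \<bullet> (matrix_inv a *v u) + (v - (transpose b ** matrix_inv a) *v u)
          \<bullet> (matrix_inv (schur d (transpose b) a) *v (v - (transpose b ** matrix_inv a) *v u))"
      (is "?Q = ?R2")
proof -
  note blocks = pos_def_imp_blocks[OF C, folded a_def b_def d_def]
  define p q where "p = fst (split_vec (matrix_inv C *v join_vec u v))"
    and "q = snd (split_vec (matrix_inv C *v join_vec u v))"
  have pq: "matrix_inv C *v join_vec u v = join_vec p q"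
    by (simp add: p_def q_def)
  then have "C *v join_vec p q = join_vec u v"
    using matrix_inv_vector(1)[OF pos_def_invertible[OF C]] by metis
  then have "split_vec (join_vec (a *v p + b *v q) (transpose b *v p + d *v q)) = split_vec (join_vec u v)"
    by (simp only: matrix_vector_mult_join_vec blocks a_def[symmetric] b_def[symmetric] d_def[symmetric])
  then have uv: "u = a *v p + b *v q" "v = transpose b *v p + d *v q"
    by auto
  have Q: "?Q = u \<bullet> p + v \<bullet> q"
    by (simp add: pq inner_join_vec)
  show "?Q = ?R1"
    unfolding Q blocks_quadratic_form[OF blocks(2) uv] by (simp only: matrix_vector_mul_assoc)
  have "v \<bullet> q + u \<bullet> p = ?R2"
    using blocks_quadratic_form[OF pos_def_blocks_swap[OF blocks(2)], of v q p u] uv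
    by (simp add: matrix_vector_mul_assoc add.commute)
  then show "?Q = ?R2" by (simp add: Q add.commute)
qed

text \<open>Integrating out \<open>u\<close> and then \<open>v\<close> shows that the total mass is
  \<open>c\<close>. The two conclusions treat the two orders of the pair, one for each factorization
  of the joint density.\<close>

lemma normalizing_constant_eq_1:
  fixes h :: "'c::euclidean_space \<Rightarrow> real" and k :: "'c \<Rightarrow> 'b::euclidean_space \<Rightarrow> real"
  assumes c: "0 \<le> c" and h: "\<And>v. 0 \<le> h v"
    and [measurable]: "h \<in> borel_measurable borel" "(\<lambda>(u, v). k v u) \<in> borel_measurable (borel \<Otimes>\<^sub>M borel)"
      "\<And>v. k v \<in> borel_measurable borel"
    and int: "(\<integral>\<^sup>+v. ennreal (h v) \<partial>lborel) = 1" "\<And>v. (\<integral>\<^sup>+u. ennreal (k v u) \<partial>lborel) = 1"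
  shows "(\<integral>\<^sup>+(u, v). ennreal (c * (h v * k v u)) \<partial>(lborel \<Otimes>\<^sub>M lborel)) = 1 \<Longrightarrow> c = 1"
    and "(\<integral>\<^sup>+(v, u). ennreal (c * (h v * k v u)) \<partial>(lborel \<Otimes>\<^sub>M lborel)) = 1 \<Longrightarrow> c = 1"
proof -
  have [measurable]: "(\<lambda>(v, u). k v u) \<in> borel_measurable (borel \<Otimes>\<^sub>M borel)"
    using measurable_compose[OF measurable_pair_swap' assms(4)] by (simp add: split_beta')
  have *: "(\<integral>\<^sup>+v. \<integral>\<^sup>+u. ennreal (c * (h v * k v u)) \<partial>lborel \<partial>lborel) = ennreal c"
  proof -
    have "(\<integral>\<^sup>+u. ennreal (c * (h v * k v u)) \<partial>lborel) = ennreal c * ennreal (h v)" for v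
    proof -
      have "(\<integral>\<^sup>+u. ennreal (c * (h v * k v u)) \<partial>lborel)
          = (\<integral>\<^sup>+u. ennreal (c * h v) * ennreal (k v u) \<partial>lborel)"
        using c h[of v] by (simp add: ennreal_mult'[symmetric] mult.assoc)
      also have "\<dots> = ennreal (c * h v)"
        by (subst nn_integral_cmult) (simp_all add: int)
      finally show ?thesis using c h[of v] by (simp add: ennreal_mult)
    qed
    then show ?thesis by (simp add: nn_integral_cmult int)
  qed
  have c1: "c = 1" if "ennreal c = 1"
    using that c by (simp add: ennreal_eq_1)
  show "c = 1" if "(\<integral>\<^sup>+(u, v). ennreal (c * (h v * k v u)) \<partial>(lborel \<Otimes>\<^sub>M lborel)) = 1"
    using that by (subst (asm) lborel_pair.nn_integral_snd[symmetric]) (measurable, simp add: * c1)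
  show "c = 1" if "(\<integral>\<^sup>+(v, u). ennreal (c * (h v * k v u)) \<partial>(lborel \<Otimes>\<^sub>M lborel)) = 1"
    using that by (subst (asm) lborel.nn_integral_fst[symmetric]) (measurable, simp add: * c1)
qed

lemma measurable_gaussian_density_pair:
  "(\<lambda>(u, v). gaussian_density (A *v v) S u) \<in> borel_measurable (borel \<Otimes>\<^sub>M borel)"
  "(\<lambda>(v, u). gaussian_density (A *v v) S u) \<in> borel_measurable (borel \<Otimes>\<^sub>M borel)"
  by (simp_all add: split_beta')

text \<open>\<open>gaussian_density 0 S 0\<close> is the normalizing factor belonging to
  \<open>S\<close>. A splitting of the exponent therefore splits the density up to a quotient of
  three such values, which stays unevaluated.\<close>

lemma gaussian_density_scaled:
  assumes "pos_def S" "pos_def T" "pos_def C"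
    and "z \<bullet> (matrix_inv C *v z) = v \<bullet> (matrix_inv S *v v) + (u - w) \<bullet> (matrix_inv T *v (u - w))"
  shows "gaussian_density 0 C z
    = gaussian_density 0 C 0 / (gaussian_density 0 S 0 * gaussian_density 0 T 0)
        * (gaussian_density 0 S v * gaussian_density w T u)"
proof -
  have "exp (- (z \<bullet> (matrix_inv C *v z) / 2)) = exp (- (v \<bullet> (matrix_inv S *v v) / 2))
      * exp (- ((u - w) \<bullet> (matrix_inv T *v (u - w)) / 2))"
    by (simp add: assms(4) add_divide_distrib flip: exp_add)
  then show ?thesis
    using pos_def_det_pos[OF assms(1)] pos_def_det_pos[OF assms(2)] pos_def_det_pos[OF assms(3)]
    by (simp add: gaussian_density_def)
qed

lemma gaussian_density_join_vec:
  assumes C: "pos_def C"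
  defines "a \<equiv> block_uu C" and "b \<equiv> block_uv C" and "d \<equiv> block_vv C"
  shows "gaussian_density 0 C (join_vec u v)
      = gaussian_density 0 d v * gaussian_density ((b ** matrix_inv d) *v v) (schur a b d) u"
    and "gaussian_density 0 C (join_vec u v)
      = gaussian_density 0 a u * gaussian_density ((transpose b ** matrix_inv a) *v u) (schur d (transpose b) a) v"
proof -
  note B = pos_def_imp_blocks(2)[OF C, folded a_def b_def d_def]
  note pd = pos_def_blocksD[OF B] pos_def_blocksD[OF pos_def_blocks_swap[OF B]]
    pos_def_schur[OF B] pos_def_schur[OF pos_def_blocks_swap[OF B], unfolded transpose_transpose]
  interpret prob_space "joint_gaussian C" by (rule prob_space_joint_gaussian[OF C])
  have m: "(\<lambda>(u, v). ennreal (gaussian_density 0 C (join_vec u v))) \<in> borel_measurable (lborel \<Otimes>\<^sub>M lborel)"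
    by (simp add: split_beta')
  have total: "(\<integral>\<^sup>+(u, v). ennreal (gaussian_density 0 C (join_vec u v)) \<partial>(lborel \<Otimes>\<^sub>M lborel)) = 1"
    (is "(\<integral>\<^sup>+x. ?f x \<partial>?L) = 1")
  proof -
    have "(\<integral>\<^sup>+x. ?f x \<partial>?L) = emeasure (density ?L ?f) (space ?L)"
      by (subst emeasure_density[OF m sets.top]) (auto intro!: nn_integral_cong)
    then show ?thesis
      using emeasure_space_1 by (simp add: joint_gaussian_eq_density)
  qed
  note quad = quadratic_form_join_vec[OF C, folded a_def b_def d_def]
  note f1 = gaussian_density_scaled[OF pd(2,3) C quad(1)]
  note f2 = gaussian_density_scaled[OF pd(1,4) C quad(2)]
  note nonneg = less_imp_le[OF gaussian_density_pos]
  \<comment> \<open>The quotient is the constant \<open>c\<close> of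
    \<open>normalizing_constant_eq_1\<close>. Rotating the premises lets the mass-one fact
    \<open>total\<close> fix the densities before the side conditions are checked.\<close>
  have "gaussian_density 0 C 0 / (gaussian_density 0 d 0 * gaussian_density 0 (schur a b d) 0) = 1"
    using total unfolding f1
    by (rule normalizing_constant_eq_1(1)[rotated -1])
      (simp_all add: nonneg pd C nn_integral_gaussian_density measurable_gaussian_density_pair)
  with f1 show "gaussian_density 0 C (join_vec u v)
      = gaussian_density 0 d v * gaussian_density ((b ** matrix_inv d) *v v) (schur a b d) u" by simp
  have "gaussian_density 0 C 0 / (gaussian_density 0 a 0 * gaussian_density 0 (schur d (transpose b) a) 0) = 1"
    using total unfolding f2
    by (rule normalizing_constant_eq_1(2)[rotated -1])
      (simp_all add: nonneg pd C nn_integral_gaussian_density measurable_gaussian_density_pair)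
  with f2 show "gaussian_density 0 C (join_vec u v)
      = gaussian_density 0 a u * gaussian_density ((transpose b ** matrix_inv a) *v u) (schur d (transpose b) a) v" by simp
qed

lemma joint_gaussian_conditional_laws:
  assumes C: "pos_def C"
  defines "a \<equiv> block_uu C" and "b \<equiv> block_uv C" and "d \<equiv> block_vv C"
  shows "distr (joint_gaussian C) borel snd = gaussian 0 d"
    and "conditional_law (joint_gaussian C) fst snd (\<lambda>v. gaussian ((b ** matrix_inv d) *v v) (schur a b d))"
    and "distr (joint_gaussian C) borel fst = gaussian 0 a"
    and "conditional_law (joint_gaussian C) snd fst
      (\<lambda>u. gaussian ((transpose b ** matrix_inv a) *v u) (schur d (transpose b) a))"
proof -
  note B = pos_def_imp_blocks(2)[OF C, folded a_def b_def d_def]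
  note pd = pos_def_blocksD[OF B] pos_def_blocksD[OF pos_def_blocks_swap[OF B]]
    pos_def_schur[OF B] pos_def_schur[OF pos_def_blocks_swap[OF B], unfolded transpose_transpose]
  note factor = gaussian_density_join_vec[OF C, folded a_def b_def d_def]
  note nonneg = less_imp_le[OF gaussian_density_pos]
  have m1: "(\<lambda>(u, v). ennreal (gaussian_density (A *v v) S u)) \<in> borel_measurable (borel \<Otimes>\<^sub>M borel)"
    for A :: "real^'b^'a" and S
    by (simp add: split_beta')
  have m2: "(\<lambda>(u, v). ennreal (gaussian_density (A *v u) S v)) \<in> borel_measurable (borel \<Otimes>\<^sub>M borel)"
    for A :: "real^'a^'b" and S
    by (simp add: split_beta')
  have D1: "joint_gaussian C = density (lborel \<Otimes>\<^sub>M lborel) (\<lambda>(u, v). ennreal (gaussian_density 0 d v)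
      * ennreal (gaussian_density ((b ** matrix_inv d) *v v) (schur a b d) u))"
    unfolding joint_gaussian_eq_density factor(1)
    by (simp add: ennreal_mult nonneg pd)
  have D2: "joint_gaussian C = density (lborel \<Otimes>\<^sub>M lborel) (\<lambda>(u, v). ennreal (gaussian_density 0 a u)
      * ennreal (gaussian_density ((transpose b ** matrix_inv a) *v u) (schur d (transpose b) a) v))"
    unfolding joint_gaussian_eq_density factor(2)
    by (simp add: ennreal_mult nonneg pd)
  note L1 = conditional_law_fst_snd[OF prob_space_joint_gaussian[OF C] _ m1 _ D1, folded gaussian_eq_density]
  show "distr (joint_gaussian C) borel snd = gaussian 0 d"
    by (rule L1(1)) (simp_all add: measurable_gaussian_prob_algebra pd)
  show "conditional_law (joint_gaussian C) fst snd (\<lambda>v. gaussian ((b ** matrix_inv d) *v v) (schur a b d))"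
    by (rule L1(2)) (simp_all add: measurable_gaussian_prob_algebra pd)
  note L2 = conditional_law_snd_fst[OF prob_space_joint_gaussian[OF C] _ m2 _ D2, folded gaussian_eq_density]
  show "distr (joint_gaussian C) borel fst = gaussian 0 a"
    by (rule L2(1)) (simp_all add: measurable_gaussian_prob_algebra pd)
  show "conditional_law (joint_gaussian C) snd fst
      (\<lambda>u. gaussian ((transpose b ** matrix_inv a) *v u) (schur d (transpose b) a))"
    by (rule L2(2)) (simp_all add: measurable_gaussian_prob_algebra pd)
qed

section \<open>The tilted model\<close>

lemma pair_gaussian:
  fixes S :: "real^'m^'m" and T :: "real^'n^'n"
  assumes "pos_def S" "pos_def T"
  shows "gaussian m S \<Otimes>\<^sub>M gaussian n T = density (lborel \<Otimes>\<^sub>M lborel)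
    (\<lambda>(u, v). ennreal (gaussian_density m S u) * ennreal (gaussian_density n T v))"
proof -
  interpret T: prob_space "gaussian n T" by (rule prob_space_gaussian[OF assms(2)])
  have "sigma_finite_measure (density lborel (\<lambda>x. ennreal (gaussian_density n T x)))"
    using T.sigma_finite_measure_axioms by (simp add: gaussian_eq_density)
  then show ?thesis
    unfolding gaussian_eq_density
    by (intro pair_measure_density lborel.sigma_finite_measure_axioms) measurable
qed

lemma tilted_normalizer_finite:
  fixes a :: "real^'m^'m" and b :: "real^'n^'m" and d :: "real^'n^'n"
  assumes B: "pos_def_blocks a b d" and A: "A = matrix_inv a ** b ** matrix_inv d"
  obtains \<kappa> where "0 < \<kappa>"
    "(\<integral>\<^sup>+(u, v). ennreal (exp (u \<bullet> (A *v v))) \<partial>(gaussian 0 a \<Otimes>\<^sub>M gaussian 0 d)) = ennreal \<kappa>"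
proof -
  note a = pos_def_blocksD[OF B] and d = pos_def_blocksD[OF pos_def_blocks_swap[OF B]]
  note inva = pos_def_invertible[OF a] and invd = pos_def_invertible[OF d]
  interpret a: prob_space "gaussian 0 a" by (rule prob_space_gaussian[OF a])
  interpret d: prob_space "gaussian 0 d" by (rule prob_space_gaussian[OF d])
  interpret pair_sigma_finite "gaussian 0 a" "gaussian 0 d" ..
  have symd: "transpose (matrix_inv d) = matrix_inv d"
    using pos_def_matrix_inv[OF d] by (simp add: pos_def_def)
  \<comment> \<open>Integrating \<open>u\<close> out of the tilted density leaves the exponent
    \<open>- (v \<bullet> (W *v v)) / 2\<close>, so \<open>W\<close> is the precision of the
    \<open>v\<close>-marginal of \<nu>; it equals
    \<open>matrix_inv d - transpose A ** a ** A\<close>, written here as a congruence to expose its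
    positivity.\<close>
  define W where "W = transpose (matrix_inv d) ** schur d (transpose b) a ** matrix_inv d"
  have W: "pos_def W"
    unfolding W_def by (intro pos_def_congruence invertible_matrix_inv invd
      pos_def_schur[OF pos_def_blocks_swap[OF B], unfolded transpose_transpose])
  note invW = pos_def_invertible[OF W]
  have quad: "v \<bullet> (matrix_inv d *v v) - (A *v v) \<bullet> (a *v (A *v v)) = v \<bullet> (W *v v)" for v
  proof -
    let ?y = "matrix_inv d *v v"
    have Av: "A *v v = matrix_inv a *v (b *v ?y)"
      by (simp add: A matrix_vector_mul_assoc matrix_mul_assoc)
    have "(A *v v) \<bullet> (a *v (A *v v)) = ?y \<bullet> (transpose b *v (matrix_inv a *v (b *v ?y)))"
      using inner_matrix_vector_transpose[of "matrix_inv a *v (b *v ?y)" b ?y]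
      by (simp add: Av matrix_inv_vector inva inner_commute)
    moreover have "v \<bullet> (W *v v) = ?y \<bullet> (schur d (transpose b) a *v ?y)"
      using inner_matrix_vector_transpose[of v "matrix_inv d" "schur d (transpose b) a *v ?y"]
      by (simp add: W_def symd flip: matrix_vector_mul_assoc)
    ultimately show ?thesis
      by (simp add: schur_vector inner_diff_right matrix_inv_vector invd inner_commute)
  qed
  define s where "s = gaussian_density 0 (matrix_inv W) 0"
  \<comment> \<open>The value is forced by the identity \<open>dens\<close> below at
    \<open>v = 0\<close>: a quotient of two Gaussian normalizing factors.\<close>
  define \<kappa> where "\<kappa> = gaussian_density 0 d 0 / s"
  have s: "0 < s" unfolding s_def by (intro gaussian_density_pos pos_def_matrix_inv W)
  have \<kappa>: "0 < \<kappa>" unfolding \<kappa>_def by (intro divide_pos_pos s gaussian_density_pos d)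
  have dens: "gaussian_density 0 d v * exp ((A *v v) \<bullet> (a *v (A *v v)) / 2)
      = \<kappa> * gaussian_density 0 (matrix_inv W) v" for v
  proof -
    have "exp (- (v \<bullet> (matrix_inv d *v v)) / 2) * exp ((A *v v) \<bullet> (a *v (A *v v)) / 2)
        = exp (- (v \<bullet> (W *v v)) / 2)"
      unfolding quad[symmetric] exp_add[symmetric] by (simp add: field_simps)
    then show ?thesis
      using pos_def_det_pos[OF pos_def_matrix_inv[OF W]]
      by (simp add: \<kappa>_def s_def gaussian_density_def matrix_inv_matrix_inv invW)
  qed
  have "(\<integral>\<^sup>+(u, v). ennreal (exp (u \<bullet> (A *v v))) \<partial>(gaussian 0 a \<Otimes>\<^sub>M gaussian 0 d))
      = (\<integral>\<^sup>+v. \<integral>\<^sup>+u. ennreal (exp (u \<bullet> (A *v v))) \<partial>gaussian 0 a \<partial>gaussian 0 d)"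
    by (subst nn_integral_snd[symmetric]) (simp_all add: split_beta')
  also have "\<dots> = (\<integral>\<^sup>+v. ennreal (exp ((A *v v) \<bullet> (a *v (A *v v)) / 2)) \<partial>gaussian 0 d)"
  proof -
    have "(\<integral>\<^sup>+u. ennreal (exp (u \<bullet> w)) \<partial>gaussian 0 a) = ennreal (exp (w \<bullet> (a *v w) / 2))" for w
      unfolding inner_commute[of _ w] by (rule gaussian_exponential_moment(1)[OF a])
    then show ?thesis by simp
  qed
  also have "\<dots> = (\<integral>\<^sup>+v. ennreal (gaussian_density 0 d v * exp ((A *v v) \<bullet> (a *v (A *v v)) / 2)) \<partial>lborel)"
    unfolding gaussian_eq_density using gaussian_density_pos[OF d]
    by (subst nn_integral_density) (simp_all add: ennreal_mult less_imp_le)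
  also have "\<dots> = (\<integral>\<^sup>+v. ennreal \<kappa> * ennreal (gaussian_density 0 (matrix_inv W) v) \<partial>lborel)"
    using \<kappa> by (simp add: dens ennreal_mult')
  also have "\<dots> = ennreal \<kappa>"
    by (subst nn_integral_cmult) (simp_all add: nn_integral_gaussian_density pos_def_matrix_inv W)
  finally show thesis using that \<kappa> by blast
qed

lemma tilted_gaussian_conditional_laws:
  fixes a :: "real^'m^'m" and b :: "real^'n^'m" and d :: "real^'n^'n"
  assumes B: "pos_def_blocks a b d" and A: "A = matrix_inv a ** b ** matrix_inv d"
  defines "\<nu> \<equiv> tilted_model (gaussian 0 a) (gaussian 0 d) A"
  shows "prob_space \<nu>"
    and "conditional_law \<nu> fst snd (\<lambda>v. gaussian ((b ** matrix_inv d) *v v) a)"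
    and "conditional_law \<nu> snd fst (\<lambda>u. gaussian ((transpose b ** matrix_inv a) *v u) d)"
proof -
  note a = pos_def_blocksD[OF B] and d = pos_def_blocksD[OF pos_def_blocks_swap[OF B]]
  note inva = pos_def_invertible[OF a] and invd = pos_def_invertible[OF d]
  note nonneg = less_imp_le[OF gaussian_density_pos[OF a]] less_imp_le[OF gaussian_density_pos[OF d]]
  let ?P = "gaussian 0 a \<Otimes>\<^sub>M gaussian 0 d"
  obtain \<kappa> where \<kappa>: "0 < \<kappa>" and Z: "(\<integral>\<^sup>+(u, v). ennreal (exp (u \<bullet> (A *v v))) \<partial>?P) = ennreal \<kappa>"
    using tilted_normalizer_finite[OF B A] by blast
  have \<nu>: "\<nu> = density ?P (\<lambda>(u, v). ennreal (exp (u \<bullet> (A *v v))) / ennreal \<kappa>)"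
    by (simp add: \<nu>_def tilted_model_def Z)
  have m: "(\<lambda>(u, v). ennreal (exp (u \<bullet> (A *v v)))) \<in> borel_measurable ?P"
    by (simp add: split_beta')
  show prob: "prob_space \<nu>"
  proof
    have "emeasure \<nu> (space \<nu>) = (\<integral>\<^sup>+x. (\<lambda>(u, v). ennreal (exp (u \<bullet> (A *v v)))) x / ennreal \<kappa> \<partial>?P)"
      unfolding \<nu> space_density
      by (subst emeasure_density[OF _ sets.top])
        (auto intro!: nn_integral_cong simp: split_beta')
    also have "\<dots> = ennreal \<kappa> / ennreal \<kappa>"
      by (subst nn_integral_divide[OF m]) (simp add: Z)
    also have "\<dots> = 1" using \<kappa> by (simp add: divide_ennreal)
    finally show "emeasure \<nu> (space \<nu>) = 1" .
  qed
  have \<nu>_density: "\<nu> = density (lborel \<Otimes>\<^sub>M lborel) (\<lambda>(u, v).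
      ennreal (gaussian_density 0 a u * gaussian_density 0 d v * exp (u \<bullet> (A *v v)) / \<kappa>))"
    unfolding \<nu> pair_gaussian[OF a d]
    using \<kappa> nonneg
    by (subst density_density_eq)
      (auto simp: split_beta' divide_ennreal ennreal_mult'[symmetric] intro!: arg_cong[where f="density _"])
  \<comment> \<open>The mean shift produced by the tilt is the regression of \<open>u\<close> on
    \<open>v\<close> under \<mu>; \<open>dA\<close> is its mirror image.\<close>
  have aA: "a *v (A *v v) = (b ** matrix_inv d) *v v" for v
    by (simp add: A matrix_inv_vector inva flip: matrix_vector_mul_assoc)
  have At: "transpose A = matrix_inv d ** (transpose b ** matrix_inv a)"
    using pos_def_matrix_inv[OF a] pos_def_matrix_inv[OF d]
    by (simp add: A matrix_transpose_mul pos_def_def matrix_mul_assoc)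
  have dA: "d *v (transpose A *v u) = (transpose b ** matrix_inv a) *v u" for u
    by (simp add: At matrix_inv_vector invd flip: matrix_vector_mul_assoc)
  \<comment> \<open>\<open>h\<close> and \<open>g\<close> collect what completing the square leaves
    in the conditioning variable alone, the normalization included; they are the marginal densities
    of \<nu>.\<close>
  define h where "h v = gaussian_density 0 d v * exp ((A *v v) \<bullet> (a *v (A *v v)) / 2) / \<kappa>" for v
  define g where "g u = gaussian_density 0 a u * exp ((transpose A *v u) \<bullet> (d *v (transpose A *v u)) / 2) / \<kappa>" for u
  have hg: "0 \<le> h v" "0 \<le> g u" for u v
    using \<kappa> nonneg by (auto simp: h_def g_def)
  have [measurable]: "h \<in> borel_measurable borel" "g \<in> borel_measurable borel"
    unfolding h_def g_def by measurable
  have "gaussian_density 0 a u * gaussian_density 0 d v * exp (u \<bullet> (A *v v)) / \<kappa>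
      = h v * gaussian_density ((b ** matrix_inv d) *v v) a u" for u v
    using gaussian_density_exp_inner[OF a, of u "A *v v"]
    by (simp add: h_def aA inner_commute mult_ac)
  then have D1: "\<nu> = density (lborel \<Otimes>\<^sub>M lborel) (\<lambda>(u, v).
      ennreal (h v) * ennreal (gaussian_density ((b ** matrix_inv d) *v v) a u))"
    unfolding \<nu>_density using nonneg hg by (simp add: ennreal_mult)
  have "gaussian_density 0 a u * gaussian_density 0 d v * exp (u \<bullet> (A *v v)) / \<kappa>
      = g u * gaussian_density ((transpose b ** matrix_inv a) *v u) d v" for u v
    using gaussian_density_exp_inner[OF d, of v "transpose A *v u"]
    by (simp add: g_def dA inner_matrix_vector_transpose[of u A v] mult_ac)
  then have D2: "\<nu> = density (lborel \<Otimes>\<^sub>M lborel) (\<lambda>(u, v).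
      ennreal (g u) * ennreal (gaussian_density ((transpose b ** matrix_inv a) *v u) d v))"
    unfolding \<nu>_density using nonneg hg by (simp add: ennreal_mult)
  have m1: "(\<lambda>(u, v). ennreal (gaussian_density ((b ** matrix_inv d) *v v) a u)) \<in> borel_measurable (borel \<Otimes>\<^sub>M borel)"
    and m2: "(\<lambda>(u, v). ennreal (gaussian_density ((transpose b ** matrix_inv a) *v u) d v)) \<in> borel_measurable (borel \<Otimes>\<^sub>M borel)"
    by (simp_all add: split_beta')
  show "conditional_law \<nu> fst snd (\<lambda>v. gaussian ((b ** matrix_inv d) *v v) a)"
    by (rule conditional_law_fst_snd(2)[OF prob _ m1 _ D1, folded gaussian_eq_density])
      (simp_all add: measurable_gaussian_prob_algebra a)
  show "conditional_law \<nu> snd fst (\<lambda>u. gaussian ((transpose b ** matrix_inv a) *v u) d)"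
    by (rule conditional_law_snd_fst(2)[OF prob _ m2 _ D2, folded gaussian_eq_density])
      (simp_all add: measurable_gaussian_prob_algebra d)
qed

section \<open>The conditional loss\<close>

text \<open>For the Frobenius inner product, left multiplication by \<open>transpose X\<close> is
  adjoint to left multiplication by \<open>X\<close>; this moves factors across
  \<open>\<bullet>\<close> in the loss.\<close>

lemma inner_matrix_mult_left:
  fixes X :: "real^'n^'m" and Y :: "real^'k^'n" and Z :: "real^'k^'m"
  shows "(X ** Y) \<bullet> Z = Y \<bullet> (transpose X ** Z)"
proof -
  have "(X ** Y) \<bullet> Z = (\<Sum>i\<in>UNIV. \<Sum>j\<in>UNIV. \<Sum>k\<in>UNIV. X $ i $ k * Y $ k $ j * Z $ i $ j)"
    by (simp add: inner_vec_def matrix_matrix_mult_def sum_distrib_right)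
  also have "\<dots> = (\<Sum>k\<in>UNIV. \<Sum>j\<in>UNIV. \<Sum>i\<in>UNIV. X $ i $ k * Y $ k $ j * Z $ i $ j)"
    (is "?l = ?r")
  proof -
    have "?l = (\<Sum>i\<in>UNIV. \<Sum>k\<in>UNIV. \<Sum>j\<in>UNIV. X $ i $ k * Y $ k $ j * Z $ i $ j)"
      by (rule sum.cong[OF refl]) (rule sum.swap)
    also have "\<dots> = (\<Sum>k\<in>UNIV. \<Sum>i\<in>UNIV. \<Sum>j\<in>UNIV. X $ i $ k * Y $ k $ j * Z $ i $ j)"
      by (rule sum.swap)
    also have "\<dots> = ?r"
      by (rule sum.cong[OF refl]) (rule sum.swap)
    finally show ?thesis .
  qed
  also have "\<dots> = Y \<bullet> (transpose X ** Z)"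
    by (simp add: inner_vec_def matrix_matrix_mult_def transpose_def sum_distrib_left mult_ac)
  finally show ?thesis .
qed

lemma inner_transpose_transpose:
  fixes X Y :: "real^'n^'m"
  shows "transpose X \<bullet> transpose Y = X \<bullet> Y"
  unfolding inner_vec_def transpose_def by (simp add: inner_vec_def) (rule sum.swap)

lemma inner_matrix_mult_right:
  fixes X :: "real^'n^'m" and Y :: "real^'k^'n" and Z :: "real^'k^'m"
  shows "(X ** Y) \<bullet> Z = X \<bullet> (Z ** transpose Y)"
  using inner_matrix_mult_left[of "transpose Y" "transpose X" "transpose Z"]
    inner_transpose_transpose[of "X ** Y" Z] inner_transpose_transpose[of X "Z ** transpose Y"]
  by (simp add: matrix_transpose_mul)

text \<open>With \<open>a = Q ** transpose Q\<close> and \<open>d = R ** transpose R\<close>, the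
  value is the squared Frobenius norm of \<open>transpose Q ** D ** R\<close>, and invertible
  factors keep this matrix nonzero. In other words, the Kronecker product of \<open>d\<close> and
  \<open>a\<close> is positive definite.\<close>

lemma pos_def_kronecker:
  fixes a :: "real^'m^'m" and d :: "real^'n^'n" and D :: "real^'n^'m"
  assumes "pos_def a" "pos_def d" "D \<noteq> 0"
  shows "0 < D \<bullet> (a ** D ** d)"
proof -
  obtain Q :: "real^'m^'m" where Q: "invertible Q" "a = Q ** transpose Q"
    using assms(1) by (rule pos_def_factor)
  obtain R :: "real^'n^'n" where R: "invertible R" "d = R ** transpose R"
    using assms(2) by (rule pos_def_factor)
  let ?E = "transpose Q ** D ** R"
  have "D \<bullet> (a ** D ** d) = D \<bullet> (Q ** (?E ** transpose R))"
    by (simp add: Q R matrix_mul_assoc)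
  also have "\<dots> = ?E \<bullet> ?E"
    using inner_matrix_mult_left[of Q "?E ** transpose R" D] inner_matrix_mult_right[of ?E "transpose R" "transpose Q ** D"]
    by (simp add: inner_commute)
  finally have E: "D \<bullet> (a ** D ** d) = ?E \<bullet> ?E" .
  have "?E \<noteq> 0"
  proof
    assume "?E = 0"
    then have "transpose (matrix_inv Q) ** ?E ** matrix_inv R = 0"
      by (simp add: vec_eq_iff matrix_matrix_mult_def)
    moreover have "transpose (matrix_inv Q) ** ?E ** matrix_inv R
        = transpose (Q ** matrix_inv Q) ** D ** (R ** matrix_inv R)"
      by (simp add: matrix_transpose_mul matrix_mul_assoc)
    ultimately show False
      using Q R assms(3) by (simp add: matrix_inv_right transpose_mat)
  qed
  then show ?thesis by (simp add: E)
qed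

lemma joint_gaussian_second_moment:
  fixes C :: "real^('m::finite + 'n::finite)^('m + 'n)"
  assumes C: "pos_def C"
  shows "integrable (joint_gaussian C) (\<lambda>w. fst w $ i * snd w $ j)"
    and "(\<integral>w. fst w $ i * snd w $ j \<partial>joint_gaussian C) = block_uv C $ i $ j"
proof -
  have m: "(\<lambda>w::(real^'m) \<times> (real^'n). fst w $ i * snd w $ j) \<in> borel_measurable borel"
    by (intro borel_measurable_continuous_onI continuous_intros)
  have split: "split_vec \<in> gaussian 0 C \<rightarrow>\<^sub>M borel" by measurable
  show "integrable (joint_gaussian C) (\<lambda>w. fst w $ i * snd w $ j)"
    unfolding joint_gaussian_def integrable_distr_eq[OF split m]
    using gaussian_second_moment(1)[OF C, of "Inl i" "Inr j"] by (simp add: split_vec_def)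
  show "(\<integral>w. fst w $ i * snd w $ j \<partial>joint_gaussian C) = block_uv C $ i $ j"
    unfolding joint_gaussian_def integral_distr[OF split m]
    using gaussian_second_moment(2)[OF C, of "Inl i" "Inr j"] by (simp add: split_vec_def block_uv_def)
qed

text \<open>The logarithm of either inner integral is a quadratic form, and averaging it over the
  other marginal gives the same value in both orders, so the two weights of one half add up to a
  single term. Each inner integral runs over one marginal only and is finite for every
  \<open>B\<close>, even where the joint normalizing constant is infinite.\<close>

lemma cond_loss_joint_gaussian:
  fixes C :: "real^('m::finite + 'n::finite)^('m + 'n)"
  assumes C: "pos_def C"
  shows "cond_loss (joint_gaussian C) B
    = (B \<bullet> (block_uu C ** B ** block_vv C)) / 2 - B \<bullet> block_uv C"
proof -
  let ?a = "block_uu C" and ?d = "block_vv C"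
  note P = pos_def_imp_blocks(2)[OF C]
  note a = pos_def_blocksD[OF P] and d = pos_def_blocksD[OF pos_def_blocks_swap[OF P]]
  have sym: "transpose ?a = ?a" "transpose ?d = ?d"
    using a d by (simp_all add: pos_def_def)
  have "(\<integral>(u, v). u \<bullet> (B *v v) \<partial>joint_gaussian C)
      = (\<integral>w. (\<Sum>i\<in>UNIV. \<Sum>j\<in>UNIV. B $ i $ j * (fst w $ i * snd w $ j)) \<partial>joint_gaussian C)"
    by (intro Bochner_Integration.integral_cong refl)
      (simp add: split_beta' inner_vec_def matrix_vector_mult_def sum_distrib_left mult_ac)
  also have "\<dots> = B \<bullet> block_uv C"
    by (simp add: joint_gaussian_second_moment C inner_vec_def)
  finally have lin: "(\<integral>(u, v). u \<bullet> (B *v v) \<partial>joint_gaussian C) = B \<bullet> block_uv C" .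
  have "(\<integral>v. exp (u \<bullet> (B *v v)) \<partial>gaussian 0 ?d) = exp (u \<bullet> ((B ** ?d ** transpose B) *v u) / 2)" for u
    using gaussian_exponential_moment(2)[OF d, of "transpose B *v u"]
      inner_matrix_vector_transpose[of u B "?d *v (transpose B *v u)"]
    by (simp add: inner_matrix_vector_transpose[of u B] matrix_vector_mul_assoc matrix_mul_assoc)
  then have "(\<integral>u. ln (\<integral>v. exp (u \<bullet> (B *v v)) \<partial>gaussian 0 ?d) \<partial>gaussian 0 ?a) = ((B ** ?d ** transpose B) \<bullet> ?a) / 2"
    by (simp add: gaussian_quadratic_form a)
  also have "(B ** ?d ** transpose B) \<bullet> ?a = B \<bullet> (?a ** B ** ?d)"
    using inner_matrix_mult_right[of "B ** ?d" "transpose B" ?a] inner_matrix_mult_right[of B ?d "?a ** B"]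
    by (simp add: sym)
  finally have u: "(\<integral>u. ln (\<integral>v. exp (u \<bullet> (B *v v)) \<partial>gaussian 0 ?d) \<partial>gaussian 0 ?a) = (B \<bullet> (?a ** B ** ?d)) / 2" .
  have "(\<integral>u. exp (u \<bullet> (B *v v)) \<partial>gaussian 0 ?a) = exp (v \<bullet> ((transpose B ** ?a ** B) *v v) / 2)" for v
    using gaussian_exponential_moment(2)[OF a, of "B *v v"]
      inner_matrix_vector_transpose[of v "transpose B" "?a *v (B *v v)"]
    by (simp add: inner_commute[of _ "B *v v"] matrix_vector_mul_assoc matrix_mul_assoc)
  then have "(\<integral>v. ln (\<integral>u. exp (u \<bullet> (B *v v)) \<partial>gaussian 0 ?a) \<partial>gaussian 0 ?d) = ((transpose B ** ?a ** B) \<bullet> ?d) / 2"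
    by (simp add: gaussian_quadratic_form d)
  also have "(transpose B ** ?a ** B) \<bullet> ?d = B \<bullet> (?a ** B ** ?d)"
    using inner_matrix_mult_left[of "transpose B ** ?a" B ?d]
    by (simp add: matrix_transpose_mul sym)
  finally have v: "(\<integral>v. ln (\<integral>u. exp (u \<bullet> (B *v v)) \<partial>gaussian 0 ?a) \<partial>gaussian 0 ?d) = (B \<bullet> (?a ** B ** ?d)) / 2" .
  show ?thesis
    by (simp add: cond_loss_def Let_def joint_gaussian_conditional_laws[OF C] lin u v)
qed

text \<open>Because \<open>A\<close> solves the stationarity equation \<open>aAd\<close>, the
  first-order term in \<open>D = B - A\<close> cancels, and the loss difference is half the form of
  \<open>pos_def_kronecker\<close> at \<open>D\<close>.\<close>

lemma cond_loss_strict_minimizer: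
  fixes C :: "real^('m::finite + 'n::finite)^('m + 'n)"
  assumes C: "pos_def C"
    and A: "A = matrix_inv (block_uu C) ** block_uv C ** matrix_inv (block_vv C)" and "B \<noteq> A"
  shows "cond_loss (joint_gaussian C) A < cond_loss (joint_gaussian C) B"
proof -
  let ?a = "block_uu C" and ?b = "block_uv C" and ?d = "block_vv C"
  note P = pos_def_imp_blocks(2)[OF C]
  note a = pos_def_blocksD[OF P] and d = pos_def_blocksD[OF pos_def_blocks_swap[OF P]]
  have sym: "transpose ?a = ?a" "transpose ?d = ?d"
    using a d by (simp_all add: pos_def_def)
  have "?a ** A ** ?d = (?a ** matrix_inv ?a) ** ?b ** (matrix_inv ?d ** ?d)"
    by (simp add: A matrix_mul_assoc)
  then have aAd: "?a ** A ** ?d = ?b"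
    by (simp add: matrix_inv pos_def_invertible a d)
  define D where "D = B - A"
  have B: "B = A + D" by (simp add: D_def)
  have lin: "?a ** (A + D) ** ?d = ?b + ?a ** D ** ?d"
  proof -
    have "(X + Y) ** ?d = X ** ?d + Y ** ?d" for X Y :: "real^'n^'m"
      by (simp add: vec_eq_iff matrix_matrix_mult_def sum.distrib algebra_simps)
    then show ?thesis by (simp add: matrix_add_ldistrib aAd)
  qed
  have "A \<bullet> (?a ** D ** ?d) = D \<bullet> ?b"
    using inner_matrix_mult_right[of "?a ** D" ?d A] inner_matrix_mult_left[of ?a D "A ** ?d"]
    by (simp add: sym matrix_mul_assoc aAd inner_commute)
  then have "cond_loss (joint_gaussian C) B - cond_loss (joint_gaussian C) A = (D \<bullet> (?a ** D ** ?d)) / 2"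
    unfolding cond_loss_joint_gaussian[OF C] B lin aAd
    by (simp add: inner_add_left inner_add_right field_simps)
  moreover have "0 < D \<bullet> (?a ** D ** ?d)"
    using pos_def_kronecker[OF a d, of D] assms(3) by (simp add: D_def)
  ultimately show ?thesis by simp
qed

section \<open>Product form and the Loewner comparison\<close>

lemma joint_gaussian_product_iff:
  fixes C :: "real^('m::finite + 'n::finite)^('m + 'n)"
  assumes C: "pos_def C"
  shows "joint_gaussian C = gaussian 0 (block_uu C) \<Otimes>\<^sub>M gaussian 0 (block_vv C) \<longleftrightarrow> block_uv C = 0"
proof
  let ?a = "block_uu C" and ?d = "block_vv C"
  note P = pos_def_imp_blocks(2)[OF C]
  note a = pos_def_blocksD[OF P] and d = pos_def_blocksD[OF pos_def_blocks_swap[OF P]]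
  note nonneg = less_imp_le[OF gaussian_density_pos]
  show "block_uv C = 0" if eq: "joint_gaussian C = gaussian 0 ?a \<Otimes>\<^sub>M gaussian 0 ?d"
  proof -
    interpret a: prob_space "gaussian 0 ?a" by (rule prob_space_gaussian[OF a])
    interpret d: prob_space "gaussian 0 ?d" by (rule prob_space_gaussian[OF d])
    interpret pair_sigma_finite "gaussian 0 ?a" "gaussian 0 ?d" ..
    \<comment> \<open>Under a product law the mean of \<open>u $ i * v $ j\<close> is a product of
      means, and these are zero; under \<mu> it is an entry of the cross-covariance.\<close>
    have "block_uv C $ i $ j = 0" for i j
    proof -
      have int: "integrable (gaussian 0 ?a \<Otimes>\<^sub>M gaussian 0 ?d) (\<lambda>(u, v). u $ i * v $ j)"
        using joint_gaussian_second_moment(1)[OF C, of i j] by (simp add: eq split_beta')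
      have "block_uv C $ i $ j = (\<integral>(u, v). u $ i * v $ j \<partial>(gaussian 0 ?a \<Otimes>\<^sub>M gaussian 0 ?d))"
        using joint_gaussian_second_moment(2)[OF C, of i j] by (simp add: eq split_beta')
      also have "\<dots> = (\<integral>u. \<integral>v. u $ i * v $ j \<partial>gaussian 0 ?d \<partial>gaussian 0 ?a)"
        using integral_fst'[OF int] by simp
      also have "\<dots> = 0" by (simp add: gaussian_first_moment d)
      finally show ?thesis .
    qed
    then show ?thesis by (simp add: vec_eq_iff)
  qed
  show "joint_gaussian C = gaussian 0 ?a \<Otimes>\<^sub>M gaussian 0 ?d" if b: "block_uv C = 0"
  proof -
    have z: "(0 :: real^'n^'m) ** X = 0" for X :: "real^'n^'n"
      by (simp add: vec_eq_iff matrix_matrix_mult_def)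
    have z': "(0 :: real^'n^'m) ** X = 0" for X :: "real^'m^'n"
      by (simp add: vec_eq_iff matrix_matrix_mult_def)
    \<comment> \<open>Without a cross block the Schur complement is the block itself and the
      conditional mean is zero, so the conditional factor is the marginal density of
      \<open>u\<close>.\<close>
    have "gaussian_density 0 C (join_vec u v) = gaussian_density 0 ?a u * gaussian_density 0 ?d v" for u v
      unfolding gaussian_density_join_vec(1)[OF C] b z schur_def z' by simp
    then show ?thesis
      unfolding joint_gaussian_eq_density pair_gaussian[OF a d]
      by (simp add: ennreal_mult nonneg a d)
  qed
qed

text \<open>The difference is \<open>b ** matrix_inv d ** transpose b\<close>, whose form at
  \<open>x\<close> is that of \<open>matrix_inv d\<close> at \<open>transpose b *v x\<close>. It
  vanishes on the kernel of \<open>transpose b\<close>, so it may be singular, but it vanishes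
  everywhere only for \<open>b = 0\<close>.\<close>

lemma loewner_less_schur:
  assumes B: "pos_def_blocks a b d" and "b \<noteq> 0"
  shows "loewner_less (schur a b d) a"
  unfolding loewner_less_def pos_semidef_def
proof (intro conjI allI)
  have d: "pos_def d" using pos_def_blocksD[OF pos_def_blocks_swap[OF B]] .
  have D: "a - schur a b d = b ** matrix_inv d ** transpose b" by (simp add: schur_def)
  have inv: "pos_def (matrix_inv d)" by (rule pos_def_matrix_inv[OF d])
  show "transpose (a - schur a b d) = a - schur a b d"
    using inv by (simp add: D matrix_transpose_mul pos_def_def matrix_mul_assoc)
  have quad: "x \<bullet> ((a - schur a b d) *v x) = (transpose b *v x) \<bullet> (matrix_inv d *v (transpose b *v x))" for x
    unfolding D by (simp add: inner_matrix_vector_transpose[of x b] flip: matrix_vector_mul_assoc)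
  show "0 \<le> x \<bullet> ((a - schur a b d) *v x)" for x
    unfolding quad using inv unfolding pos_def_def
    by (metis inner_zero_left less_eq_real_def)
  show "schur a b d \<noteq> a"
  proof
    assume "schur a b d = a"
    then have "(transpose b *v x) \<bullet> (matrix_inv d *v (transpose b *v x)) = 0" for x
      using quad[of x] by simp
    then have "transpose b *v x = 0" for x
      using inv unfolding pos_def_def by (metis less_irrefl)
    then have "transpose b = 0"
      by (simp add: matrix_eq)
    then have "transpose (transpose b) = transpose (0 :: real^'a^'b)" by simp
    then have "b = 0" by (simp only: transpose_transpose) (simp add: transpose_def vec_eq_iff)
    with assms(2) show False by simp
  qed
qed

theorem corollary5p2:
  fixes C :: "real^('m::finite + 'n::finite)^('m + 'n)"
    and G :: "real^'m^'k" and H :: "real^'n^'k" and A :: "real^'n^'m"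
  defines "Cuu \<equiv> block_uu C" and "Cuv \<equiv> block_uv C"
    and "Cvu \<equiv> block_vu C" and "Cvv \<equiv> block_vv C"
  defines "\<mu> \<equiv> joint_gaussian C"
  defines "\<mu>u \<equiv> distr \<mu> borel fst" and "\<mu>v \<equiv> distr \<mu> borel snd"
  defines "\<nu> \<equiv> tilted_model \<mu>u \<mu>v A"
  defines "\<mu>_u_given_v \<equiv> (\<lambda>v. gaussian ((Cuv ** matrix_inv Cvv) *v v)
                                         (Cuu - Cuv ** matrix_inv Cvv ** Cvu))"
    and "\<mu>_v_given_u \<equiv> (\<lambda>u. gaussian ((Cvu ** matrix_inv Cuu) *v u)
                                         (Cvv - Cvu ** matrix_inv Cuu ** Cuv))"
    and "\<nu>_u_given_v \<equiv> (\<lambda>v. gaussian ((Cuv ** matrix_inv Cvv) *v v) Cuu)"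
    and "\<nu>_v_given_u \<equiv> (\<lambda>u. gaussian ((Cvu ** matrix_inv Cuu) *v u) Cvv)"
  assumes "pos_def C"
    and "A = transpose G ** H"
    and "A = matrix_inv Cuu ** Cuv ** matrix_inv Cvv"
  shows
    "\<mu>u = gaussian 0 Cuu \<and> \<mu>v = gaussian 0 Cvv
     \<and> conditional_law \<mu> fst snd \<mu>_u_given_v
     \<and> conditional_law \<mu> snd fst \<mu>_v_given_u
     \<and> (\<forall>B. B \<noteq> A \<longrightarrow> cond_loss \<mu> A < cond_loss \<mu> B)
     \<and> prob_space \<nu>
     \<and> conditional_law \<nu> fst snd \<nu>_u_given_v
     \<and> conditional_law \<nu> snd fst \<nu>_v_given_u
     \<and> (\<forall>v. mean_vec (\<nu>_u_given_v v) = mean_vec (\<mu>_u_given_v v))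
     \<and> (\<forall>u. mean_vec (\<nu>_v_given_u u) = mean_vec (\<mu>_v_given_u u))
     \<and> (\<mu> \<noteq> \<mu>u \<Otimes>\<^sub>M \<mu>v \<longrightarrow>
          (\<forall>v. loewner_less (cov_mat (\<mu>_u_given_v v)) (cov_mat (\<nu>_u_given_v v)))
        \<and> (\<forall>u. loewner_less (cov_mat (\<mu>_v_given_u u)) (cov_mat (\<nu>_v_given_u u))))
     \<and> (\<mu> = \<mu>u \<Otimes>\<^sub>M \<mu>v \<longrightarrow>
          (\<forall>v. cov_mat (\<nu>_u_given_v v) = cov_mat (\<mu>_u_given_v v))
        \<and> (\<forall>u. cov_mat (\<nu>_v_given_u u) = cov_mat (\<mu>_v_given_u u)))"
proof -
  note C = \<open>pos_def C\<close>
  note B = pos_def_imp_blocks(2)[OF C, folded Cuu_def Cuv_def Cvv_def]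
  note B' = pos_def_blocks_swap[OF B]
  have vu: "Cvu = transpose Cuv"
    using pos_def_imp_blocks(1)[OF C] by (simp add: Cvu_def Cuv_def)
  have schur_u: "Cuu - Cuv ** matrix_inv Cvv ** Cvu = schur Cuu Cuv Cvv"
    and schur_v: "Cvv - Cvu ** matrix_inv Cuu ** Cuv = schur Cvv (transpose Cuv) Cuu"
    by (simp_all add: schur_def vu)
  note pd = pos_def_blocksD[OF B] pos_def_blocksD[OF B'] pos_def_schur[OF B] pos_def_schur[OF B']
  note laws = joint_gaussian_conditional_laws[OF C, folded Cuu_def Cuv_def Cvv_def \<mu>_def]
  have \<mu>u: "\<mu>u = gaussian 0 Cuu" and \<mu>v: "\<mu>v = gaussian 0 Cvv"
    by (simp_all add: \<mu>u_def \<mu>v_def laws)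
  \<comment> \<open>The defining equations are counted first in \<open>assms\<close>; number 15 is
    the formula for \<open>A\<close>.\<close>
  note tilted = tilted_gaussian_conditional_laws[OF B assms(15), folded \<mu>u \<mu>v, folded \<nu>_def]
  have product: "\<mu> = \<mu>u \<Otimes>\<^sub>M \<mu>v \<longleftrightarrow> Cuv = 0"
    using joint_gaussian_product_iff[OF C] by (simp add: \<mu>u \<mu>v \<mu>_def Cuu_def Cuv_def Cvv_def)
  have cov: "cov_mat (\<mu>_u_given_v v) = schur Cuu Cuv Cvv" "cov_mat (\<nu>_u_given_v v) = Cuu"
    "cov_mat (\<mu>_v_given_u u) = schur Cvv (transpose Cuv) Cuu" "cov_mat (\<nu>_v_given_u u) = Cvv" for u v
    by (simp_all add: \<mu>_u_given_v_def \<nu>_u_given_v_def \<mu>_v_given_u_def \<nu>_v_given_u_def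
        schur_u schur_v cov_mat_gaussian pd)
  have tr0: "transpose Cuv = 0 \<longleftrightarrow> Cuv = 0" and tr00: "transpose (0 :: real^'n^'m) = 0"
    by (auto simp: transpose_def vec_eq_iff)
  have schur0: "schur S 0 T = S" for S :: "real^'x^'x" and T :: "real^'y^'y"
    by (simp add: schur_def vec_eq_iff matrix_matrix_mult_def)
  show ?thesis
  proof (intro conjI allI impI)
    show "conditional_law \<mu> fst snd \<mu>_u_given_v"
      unfolding \<mu>_u_given_v_def schur_u by (rule laws(2))
    show "conditional_law \<mu> snd fst \<mu>_v_given_u"
      \<comment> \<open>\<open>Cvu\<close> is replaced only in the second round, since the left side
        of \<open>schur_v\<close> still contains it.\<close>
      unfolding \<mu>_v_given_u_def schur_v unfolding vu by (rule laws(4))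
    show "cond_loss \<mu> A < cond_loss \<mu> X" if "X \<noteq> A" for X
      using cond_loss_strict_minimizer[OF C assms(15)[unfolded Cuu_def Cuv_def Cvv_def] that]
      by (simp add: \<mu>_def)
    show "prob_space \<nu>" "conditional_law \<nu> fst snd \<nu>_u_given_v" "conditional_law \<nu> snd fst \<nu>_v_given_u"
      using tilted by (simp_all add: \<nu>_u_given_v_def \<nu>_v_given_u_def vu)
    show "mean_vec (\<nu>_u_given_v v) = mean_vec (\<mu>_u_given_v v)" for v
      by (simp add: \<mu>_u_given_v_def \<nu>_u_given_v_def schur_u mean_vec_gaussian pd)
    show "mean_vec (\<nu>_v_given_u u) = mean_vec (\<mu>_v_given_u u)" for u
      by (simp add: \<mu>_v_given_u_def \<nu>_v_given_u_def schur_v mean_vec_gaussian pd)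
    show "loewner_less (cov_mat (\<mu>_u_given_v v)) (cov_mat (\<nu>_u_given_v v))"
      "loewner_less (cov_mat (\<mu>_v_given_u u)) (cov_mat (\<nu>_v_given_u u))" if "\<mu> \<noteq> \<mu>u \<Otimes>\<^sub>M \<mu>v" for u v
      using that product loewner_less_schur[OF B] loewner_less_schur[OF B'] by (simp_all add: cov tr0)
    show "cov_mat (\<nu>_u_given_v v) = cov_mat (\<mu>_u_given_v v)"
      "cov_mat (\<nu>_v_given_u u) = cov_mat (\<mu>_v_given_u u)" if "\<mu> = \<mu>u \<Otimes>\<^sub>M \<mu>v" for u v
      using that product by (simp_all add: cov tr00 schur0)
  qed (fact \<mu>u \<mu>v)+
qed

end
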